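(* For fixed $\mathfrak{m}>0$ and any $0<\delta\ll1$, given $\rho\ge 0$ and $r-2>d/2$, let $B_s(0)\subset H^{\rho,r}$ be the closed ball around the origin with radius $s>0$. Assume that $\mathcal{F}$ is Lipschitz from $B_s(0)$ into $H^{\rho,r-2}$. Then there exist $\epsilon_*>0$, depending on $\nu,\mathfrak{m},\delta,s,\mathrm{Lip}(\mathcal{F})$, and a set $I\subset[1,2]^d$ with Lebesgue measure $\mathrm{mes}(I)=O(\delta)$, such that when $0<\epsilon<\epsilon_*$, for any $\nu\in[1,2]^d\setminus I$, the equation $$(\mathcal{L}_{\nu,\mathfrak{m}}u)(x)=\epsilon\,\mathcal{F}(u)(x),\qquad x\in\mathbb{T}^d,$$ admits a unique solution $u(x)\in B_s(0)$.
   Context: $d\ge1$ is an integer, and $\mathbb{T}^d=\mathbb{R}^d/(2\pi\mathbb{Z})^d$. For $\rho>0$, $\mathbb{T}^d_\rho=\{x\in\mathbb{C}^d/(2\pi\mathbb{Z})^d : \mathrm{Re}(x_j)\in\mathbb{T},\ |\mathrm{Im}\,x_j|\le\rho,\ j=1,\dots,d\}$, and $\mathbb{T}^d_0=\mathbb{T}^d$. For $k\in\mathbb{Z}^d$, $|k|=\sum_{i=1}^d|k_i|$. For $\rho\ge0$ and a positive integer $r$, $H^{\rho,r}$ is the Hilbert space of functions $u:\mathbb{T}^d_\rho\to\mathbb{C}$, $u(x)=\sum_{k\in\mathbb{Z}^d}\hat u_k e^{\mathrm{i}k\cdot x}$, with finite norm $\|u\|_{\rho,r}^2=\sum_{k\in\mathbb{Z}^d}|\hat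 u_k|^2e^{2|k|\rho}(1+|k|^2)^r$. For $\nu=(\nu_1,\dots,\nu_d)\in[1,2]^d$, $\mathcal{L}_{\nu,\mathfrak{m}}=\sum_{i=1}^d\nu_i^2\frac{\partial^2}{\partial x_i^2}+\mathfrak{m}$, so that $\mathcal{L}_{\nu,\mathfrak{m}}e^{\mathrm{i}k\cdot x}=\big(\mathfrak{m}-\sum_{i=1}^d\nu_i^2k_i^2\big)e^{\mathrm{i}k\cdot x}$. That $\mathcal{F}$ is Lipschitz means $\|\mathcal{F}(u_1)-\mathcal{F}(u_2)\|_{\rho,r-2}\le\mathrm{Lip}(\mathcal{F})\|u_1-u_2\|_{\rho,r}$ for all $u_1,u_2\in B_s(0)$; the typical example is $\mathcal{F}(u)(x)=f(x,u(x),Du(x),D^2u(x))$.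
   Formalization: The threshold ε_* is allowed to depend also on the norm ‖F(0)‖_{ρ,r-2}; with only ν, m, δ, s, Lip(F) the claim fails for a large constant F(u)=c, where Lip(F)=0 and the only solution εc/m leaves the ball. *)

theory Defs
  imports "HOL-Analysis.Analysis"
begin

text \<open>
  The dimension is \<open>d = CARD('d)\<close>. A function on \<open>\<complex>\<^sup>d / (2\<pi>\<int>)\<^sup>d\<close> is a function on
  \<open>complex ^ 'd\<close>; its periodicity is not assumed separately, because it follows from the
  Fourier expansion required in \<open>H_space\<close>.
\<close>

definition strip :: "real \<Rightarrow> (complex ^ 'd::finite) set" where
  "strip \<rho> = {x. \<forall>j. \<bar>Im (x $ j)\<bar> \<le> \<rho>}"

definition real_point :: "real ^ 'd::finite \<Rightarrow> complex ^ 'd" where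
  "real_point x = (\<chi> j. complex_of_real (x $ j))"

definition l1 :: "int ^ 'd::finite \<Rightarrow> real" where
  "l1 k = (\<Sum>j\<in>UNIV. \<bar>real_of_int (k $ j)\<bar>)"

definition mode :: "int ^ 'd::finite \<Rightarrow> complex ^ 'd \<Rightarrow> complex" where
  "mode k x = exp (\<i> * (\<Sum>j\<in>UNIV. of_int (k $ j) * x $ j))"

definition fourier_expansion ::
  "real \<Rightarrow> (complex ^ 'd::finite \<Rightarrow> complex) \<Rightarrow> (int ^ 'd \<Rightarrow> complex) \<Rightarrow> bool" where
  "fourier_expansion \<rho> u c \<longleftrightarrow> (\<forall>x\<in>strip \<rho>. ((\<lambda>k. c k * mode k x) has_sum u x) UNIV)"

text \<open>
  For \<open>\<rho> \<ge> 0\<close> there is at most one expansion: at \<open>x = 0\<close> unconditional convergence makes the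
  coefficients absolutely summable, and an absolutely convergent trigonometric series determines
  its coefficients.
\<close>

definition fourier_coeff ::
  "real \<Rightarrow> (complex ^ 'd::finite \<Rightarrow> complex) \<Rightarrow> int ^ 'd \<Rightarrow> complex" where
  "fourier_coeff \<rho> u = (THE c. fourier_expansion \<rho> u c)"

definition H_term ::
  "real \<Rightarrow> nat \<Rightarrow> (complex ^ 'd::finite \<Rightarrow> complex) \<Rightarrow> int ^ 'd \<Rightarrow> real" where
  "H_term \<rho> r u k =
     (cmod (fourier_coeff \<rho> u k))\<^sup>2 * exp (2 * l1 k * \<rho>) * (1 + (l1 k)\<^sup>2) ^ r"

text \<open>
  Elements are normalised to vanish outside the strip, so that equality of HOL functions is
  equality of functions on the strip. Pointwise convergence of the Fourier series on the closed
  strip is automatic when \<open>r > d/2\<close>, by the Cauchy-Schwarz inequality, so in that range every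
  coefficient family of finite norm is attained; the definition is meant for that range.
\<close>

definition H_space :: "real \<Rightarrow> nat \<Rightarrow> (complex ^ 'd::finite \<Rightarrow> complex) set" where
  "H_space \<rho> r =
     {u. (\<forall>x. x \<notin> strip \<rho> \<longrightarrow> u x = 0) \<and> (\<exists>c. fourier_expansion \<rho> u c) \<and>
         H_term \<rho> r u summable_on UNIV}"

definition H_norm :: "real \<Rightarrow> nat \<Rightarrow> (complex ^ 'd::finite \<Rightarrow> complex) \<Rightarrow> real" where
  "H_norm \<rho> r u = sqrt (\<Sum>\<^sub>\<infinity>k. H_term \<rho> r u k)"

definition H_ball :: "real \<Rightarrow> nat \<Rightarrow> real \<Rightarrow> (complex ^ 'd::finite \<Rightarrow> complex) set" where
  "H_ball \<rho> r s = {u \<in> H_space \<rho> r. H_norm \<rho> r u \<le> s}"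

definition lipschitz_on_ball ::
  "real \<Rightarrow> nat \<Rightarrow> real \<Rightarrow> real \<Rightarrow>
   ((complex ^ 'd::finite \<Rightarrow> complex) \<Rightarrow> complex ^ 'd \<Rightarrow> complex) \<Rightarrow> bool" where
  "lipschitz_on_ball \<rho> r s L F \<longleftrightarrow>
     0 \<le> L \<and>
     (\<forall>u\<in>H_ball \<rho> r s. F u \<in> H_space \<rho> (r - 2)) \<and>
     (\<forall>u\<in>H_ball \<rho> r s. \<forall>v\<in>H_ball \<rho> r s.
        H_norm \<rho> (r - 2) (\<lambda>x. F u x - F v x) \<le> L * H_norm \<rho> r (\<lambda>x. u x - v x))"

text \<open>
  The variable \<open>t\<close> below is real: differentiation is along the torus, so it also makes sense for
  \<open>\<rho> = 0\<close>, where \<open>u\<close> is meaningful at real points only. Elements of \<open>H_space \<rho> r\<close> with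
  \<open>r - 2 > d/2\<close> are twice continuously differentiable in this sense.
\<close>

definition partial_deriv ::
  "'d::finite \<Rightarrow> (complex ^ 'd \<Rightarrow> complex) \<Rightarrow> complex ^ 'd \<Rightarrow> complex" where
  "partial_deriv i u x = vector_derivative (\<lambda>t. u (x + axis i (complex_of_real t))) (at 0)"

definition L_op ::
  "real ^ 'd::finite \<Rightarrow> real \<Rightarrow> (complex ^ 'd \<Rightarrow> complex) \<Rightarrow> complex ^ 'd \<Rightarrow> complex" where
  "L_op \<nu> m u x =
     (\<Sum>i\<in>UNIV. complex_of_real ((\<nu> $ i)\<^sup>2) * partial_deriv i (partial_deriv i u) x)
     + complex_of_real m * u x"

definition freq_box :: "(real ^ 'd::finite) set" where
  "freq_box = {\<nu>. \<forall>i. 1 \<le> \<nu> $ i \<and> \<nu> $ i \<le> 2}"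

end

theory Submission
  imports Defs
begin

text \<open>
  On Fourier coefficients the equation reads \<open>\<lambda>\<^sub>k u\<^sub>k = \<epsilon> F(u)\<^sub>k\<close> with
  \<open>\<lambda>\<^sub>k = m - \<Sum>\<^sub>i \<nu>\<^sub>i\<^sup>2 k\<^sub>i\<^sup>2\<close>. Because \<open>\<nu>\<^sub>i \<ge> 1\<close>, the operator is elliptic and
  \<open>|\<lambda>\<^sub>k|\<close> is comparable to \<open>1 + |k|\<^sup>2\<close> as soon as \<open>|k|\<^sup>2 > 2 d m\<close>; moreover \<open>\<lambda>\<^sub>0 = m > 0\<close>. For
  each of the finitely many remaining \<open>k\<close> the set of \<open>\<nu>\<close> with \<open>|\<lambda>\<^sub>k| \<le> \<delta>\<close> has measure \<open>O(\<delta>)\<close>,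
  since \<open>\<lambda>\<^sub>k\<close> is strictly monotone in \<open>\<nu>\<^sub>i\<close> at speed at least \<open>2\<close> whenever \<open>k\<^sub>i \<noteq> 0\<close>. Off the
  union \<open>I\<close> of these sets, \<open>|\<lambda>\<^sub>k| \<ge> \<gamma> (1 + |k|\<^sup>2)\<close> for all \<open>k\<close>, so the inverse operator regains the
  two derivatives lost by \<open>F\<close>, and \<open>u \<mapsto> \<epsilon> L\<^sup>-\<^sup>1 F(u)\<close> is a contraction of the ball for small \<open>\<epsilon>\<close>.
\<close>

section \<open>Weighted square-summable families\<close>

definition wl2 :: "('a \<Rightarrow> real) \<Rightarrow> ('a \<Rightarrow> complex) set" where
  "wl2 w = {c. (\<lambda>k. (cmod (c k))\<^sup>2 * w k) summable_on UNIV}"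

definition wnorm :: "('a \<Rightarrow> real) \<Rightarrow> ('a \<Rightarrow> complex) \<Rightarrow> real" where
  "wnorm w c = sqrt (\<Sum>\<^sub>\<infinity>k. (cmod (c k))\<^sup>2 * w k)"

text \<open>The terms are nonnegative, so a bound on all finite partial sums is a bound on the
  infinite sum. Together with \<open>L2_set_le_wnorm\<close> this transfers inequalities for
  \<open>L2_set\<close> on finite sets, Minkowski's in particular, to \<open>wnorm\<close>.\<close>

lemma wl2_leI:
  assumes w: "\<And>k. 0 \<le> w k"
    and B: "\<And>S. finite S \<Longrightarrow> L2_set (\<lambda>k. cmod (c k) * sqrt (w k)) S \<le> B"
  shows wl2_leI_mem: "c \<in> wl2 w" and wnorm_leI: "wnorm w c \<le> B"
proof -
  have B0: "0 \<le> B" using B[of "{}"] by simp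
  have le: "(\<Sum>k\<in>S. (cmod (c k))\<^sup>2 * w k) \<le> B\<^sup>2" if "finite S" for S
  proof -
    have "(\<Sum>k\<in>S. (cmod (c k))\<^sup>2 * w k) = (L2_set (\<lambda>k. cmod (c k) * sqrt (w k)) S)\<^sup>2"
      using w by (simp add: L2_set_def power_mult_distrib sum_nonneg)
    then show ?thesis using B[OF that] by (simp add: power_mono)
  qed
  have s: "(\<lambda>k. (cmod (c k))\<^sup>2 * w k) summable_on UNIV"
    using le w by (intro nonneg_bdd_above_summable_on bdd_aboveI[of _ "B\<^sup>2"]) auto
  then show "c \<in> wl2 w" by (simp add: wl2_def)
  have "(\<Sum>\<^sub>\<infinity>k. (cmod (c k))\<^sup>2 * w k) \<le> B\<^sup>2"
    using s le by (intro infsum_le_finite_sums) auto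
  then show "wnorm w c \<le> B"
    unfolding wnorm_def using B0 by (simp add: real_le_lsqrt)
qed

lemma L2_set_le_wnorm:
  assumes w: "\<And>k. 0 \<le> w k" and c: "c \<in> wl2 w" and S: "finite S"
  shows "L2_set (\<lambda>k. cmod (c k) * sqrt (w k)) S \<le> wnorm w c"
proof -
  have "(\<Sum>k\<in>S. (cmod (c k))\<^sup>2 * w k) \<le> (\<Sum>\<^sub>\<infinity>k. (cmod (c k))\<^sup>2 * w k)"
    using c S w by (intro finite_sum_le_infsum) (auto simp: wl2_def)
  then show ?thesis
    using w by (simp add: L2_set_def wnorm_def power_mult_distrib)
qed

lemma wnorm_nonneg: "(\<And>k. 0 \<le> w k) \<Longrightarrow> 0 \<le> wnorm w c"
  by (simp add: wnorm_def infsum_nonneg)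

lemma wl2_zero: "(\<lambda>k. 0) \<in> wl2 w" and wnorm_zero: "wnorm w (\<lambda>k. 0) = 0"
  by (simp_all add: wl2_def wnorm_def)

lemma wnorm_component_le:
  assumes "\<And>k. 0 \<le> w k" "c \<in> wl2 w"
  shows "cmod (c k) * sqrt (w k) \<le> wnorm w c"
  using L2_set_le_wnorm[of w c "{k}"] assms by (simp add: L2_set_def)

lemma wnorm_eq_0D:
  assumes "\<And>k. 0 < w k" "c \<in> wl2 w" "wnorm w c = 0"
  shows "c k = 0"
  using wnorm_component_le[of w c k] assms
  by (simp add: less_imp_le mult_le_0_iff) (metis less_le_not_le)

text \<open>Domination between two different weights is what the inverse operator requires: it sends
  families with weight exponent \<open>p\<close> to families with exponent
  \<open>p + 2\<close>.\<close>

lemma wl2_scaled_le: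
  assumes w: "\<And>k. 0 \<le> w k" and v: "\<And>k. 0 \<le> v k" and c: "c \<in> wl2 w" and B: "0 \<le> B"
    and le: "\<And>k. cmod (b k) * sqrt (v k) \<le> B * (cmod (c k) * sqrt (w k))"
  shows wl2_scaled: "b \<in> wl2 v" and wnorm_scaled_le: "wnorm v b \<le> B * wnorm w c"
proof -
  have "L2_set (\<lambda>k. cmod (b k) * sqrt (v k)) S \<le> B * wnorm w c" if "finite S" for S
  proof -
    have "L2_set (\<lambda>k. cmod (b k) * sqrt (v k)) S
        \<le> L2_set (\<lambda>k. B * (cmod (c k) * sqrt (w k))) S"
      using le v by (intro L2_set_mono) auto
    also have "\<dots> = B * L2_set (\<lambda>k. cmod (c k) * sqrt (w k)) S"
      using B by (simp add: L2_set_right_distrib)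
    also have "\<dots> \<le> B * wnorm w c"
      using L2_set_le_wnorm[OF w c that] B by (simp add: mult_left_mono)
    finally show ?thesis .
  qed
  from wl2_leI[OF v this] show "b \<in> wl2 v" "wnorm v b \<le> B * wnorm w c" by auto
qed

lemma wl2_triangle:
  assumes w: "\<And>k. 0 \<le> w k" and c: "c \<in> wl2 w" and b: "b \<in> wl2 w"
  shows wl2_add: "(\<lambda>k. c k + b k) \<in> wl2 w"
    and wnorm_triangle: "wnorm w (\<lambda>k. c k + b k) \<le> wnorm w c + wnorm w b"
proof -
  have "L2_set (\<lambda>k. cmod (c k + b k) * sqrt (w k)) S \<le> wnorm w c + wnorm w b" if "finite S" for S
  proof -
    have "L2_set (\<lambda>k. cmod (c k + b k) * sqrt (w k)) S
        \<le> L2_set (\<lambda>k. cmod (c k) * sqrt (w k) + cmod (b k) * sqrt (w k)) S"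
      using w by (intro L2_set_mono)
        (auto simp: distrib_right[symmetric] intro!: mult_right_mono norm_triangle_ineq)
    also have "\<dots> \<le> L2_set (\<lambda>k. cmod (c k) * sqrt (w k)) S + L2_set (\<lambda>k. cmod (b k) * sqrt (w k)) S"
      by (rule L2_set_triangle_ineq)
    also have "\<dots> \<le> wnorm w c + wnorm w b"
      by (intro add_mono L2_set_le_wnorm w c b that)
    finally show ?thesis .
  qed
  from wl2_leI[OF w this] show "(\<lambda>k. c k + b k) \<in> wl2 w"
    "wnorm w (\<lambda>k. c k + b k) \<le> wnorm w c + wnorm w b" by auto
qed

lemma wnorm_minus_commute: "wnorm w (\<lambda>k. c k - b k) = wnorm w (\<lambda>k. b k - c k)"
  by (simp add: wnorm_def norm_minus_commute)

lemma wl2_uminus: "b \<in> wl2 w \<Longrightarrow> (\<lambda>k. - b k) \<in> wl2 w"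
  by (simp add: wl2_def)

lemma wl2_diff:
  assumes w: "\<And>k. 0 \<le> w k" and c: "c \<in> wl2 w" and b: "b \<in> wl2 w"
  shows "(\<lambda>k. c k - b k) \<in> wl2 w"
  using wl2_add[OF w c wl2_uminus[OF b]] by simp

section \<open>Completeness of balls and the contraction principle\<close>

definition wball :: "('a \<Rightarrow> real) \<Rightarrow> real \<Rightarrow> ('a \<Rightarrow> complex) set" where
  "wball w s = {c \<in> wl2 w. wnorm w c \<le> s}"

lemma Metric_space_wball:
  assumes w: "\<And>k. 0 < w k"
  shows "Metric_space (wball w s) (\<lambda>c b. wnorm w (\<lambda>k. c k - b k))"
proof
  have w': "0 \<le> w k" for k using w[of k] by simp
  fix x y :: "'a \<Rightarrow> complex"
  show "0 \<le> wnorm w (\<lambda>k. x k - y k)" by (rule wnorm_nonneg[OF w'])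
  show "wnorm w (\<lambda>k. x k - y k) = wnorm w (\<lambda>k. y k - x k)" by (rule wnorm_minus_commute)
  assume x: "x \<in> wball w s" and y: "y \<in> wball w s"
  have xy: "(\<lambda>k. x k - y k) \<in> wl2 w"
    using x y by (auto simp: wball_def intro: wl2_diff[OF w'])
  show "(wnorm w (\<lambda>k. x k - y k) = 0) = (x = y)"
    using wnorm_eq_0D[OF w xy] by (auto simp: wnorm_zero fun_eq_iff)
  fix z assume z: "z \<in> wball w s"
  have yz: "(\<lambda>k. y k - z k) \<in> wl2 w"
    using z y by (auto simp: wball_def intro: wl2_diff[OF w'])
  show "wnorm w (\<lambda>k. x k - z k) \<le> wnorm w (\<lambda>k. x k - y k) + wnorm w (\<lambda>k. y k - z k)"
    using wnorm_triangle[OF w' xy yz] by simp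
qed

text \<open>A Cauchy sequence converges componentwise, because each weighted component is bounded by
  the norm. Bounds over a finite index set survive componentwise limits, and \<open>wl2_leI\<close>
  turns them back into norm bounds; this gives both membership of the limit in the ball and
  convergence in norm.\<close>

lemma mcomplete_wball:
  assumes w: "\<And>k. 0 < w k"
  shows "Metric_space.mcomplete (wball w s) (\<lambda>c b. wnorm w (\<lambda>k. c k - b k))"
proof -
  interpret Metric_space "wball w s" "\<lambda>c b. wnorm w (\<lambda>k. c k - b k)"
    by (rule Metric_space_wball[OF w])
  have w': "0 \<le> w k" for k using w[of k] by simp
  show ?thesis
    unfolding mcomplete_def
  proof (intro allI impI)
    fix \<sigma> assume \<sigma>: "MCauchy \<sigma>"
    then have "\<sigma> n \<in> wball w s" for n
      unfolding MCauchy_def by (blast intro: rangeI)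
    then have mem: "\<sigma> n \<in> wl2 w" "wnorm w (\<sigma> n) \<le> s" for n
      by (simp_all add: wball_def)
    have diff: "(\<lambda>k. \<sigma> m k - \<sigma> n k) \<in> wl2 w" for m n
      by (intro wl2_diff w' mem)
    have "Cauchy (\<lambda>n. \<sigma> n k)" for k
    proof (rule metric_CauchyI)
      fix e :: real assume "0 < e"
      then have "0 < e * sqrt (w k)" using w by simp
      then obtain N where N: "\<And>m n. N \<le> m \<Longrightarrow> N \<le> n \<Longrightarrow>
          wnorm w (\<lambda>k. \<sigma> m k - \<sigma> n k) < e * sqrt (w k)"
        using \<sigma> unfolding MCauchy_def by blast
      have "dist (\<sigma> m k) (\<sigma> n k) < e" if "N \<le> m" "N \<le> n" for m n
      proof -
        have "cmod (\<sigma> m k - \<sigma> n k) * sqrt (w k) < e * sqrt (w k)"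
          using wnorm_component_le[OF w' diff[of m n], of k] N[OF that] by simp
        then show ?thesis using w[of k] by (simp add: dist_norm)
      qed
      then show "\<exists>M. \<forall>m\<ge>M. \<forall>n\<ge>M. dist (\<sigma> m k) (\<sigma> n k) < e" by blast
    qed
    then have "\<forall>k. \<exists>l. (\<lambda>n. \<sigma> n k) \<longlonglongrightarrow> l"
      by (simp add: Cauchy_convergent_iff convergent_def)
    then obtain l where l: "\<And>k. (\<lambda>n. \<sigma> n k) \<longlonglongrightarrow> l k" by metis
    have "L2_set (\<lambda>k. cmod (l k) * sqrt (w k)) S \<le> s" if "finite S" for S
    proof (rule tendsto_upperbound)
      show "(\<lambda>n. L2_set (\<lambda>k. cmod (\<sigma> n k) * sqrt (w k)) S)
          \<longlonglongrightarrow> L2_set (\<lambda>k. cmod (l k) * sqrt (w k)) S"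
        unfolding L2_set_def by (intro tendsto_intros l)
      show "\<forall>\<^sub>F n in sequentially. L2_set (\<lambda>k. cmod (\<sigma> n k) * sqrt (w k)) S \<le> s"
        using L2_set_le_wnorm[OF w' mem(1) that] mem(2) order_trans by (intro always_eventually) blast
    qed simp
    from wl2_leI[OF w' this] have lb: "l \<in> wball w s" by (auto simp: wball_def)
    have "limitin mtopology \<sigma> l sequentially"
      unfolding limitin_metric
    proof (intro conjI lb allI impI)
      fix e :: real assume e: "0 < e"
      \<comment> \<open>Halving \<open>e\<close> restores a strict bound at the end, since the limit
        in \<open>n\<close> preserves only the non-strict one.\<close>
      then have "0 < e / 2" by simp
      then obtain N where N: "\<And>m n. N \<le> m \<Longrightarrow> N \<le> n \<Longrightarrow>
          wnorm w (\<lambda>k. \<sigma> m k - \<sigma> n k) < e / 2"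
        using \<sigma> unfolding MCauchy_def by blast
      have "wnorm w (\<lambda>k. \<sigma> m k - l k) < e" if "N \<le> m" for m
      proof -
        have "L2_set (\<lambda>k. cmod (\<sigma> m k - l k) * sqrt (w k)) S \<le> e / 2" if S: "finite S" for S
        proof (rule tendsto_upperbound)
          show "(\<lambda>n. L2_set (\<lambda>k. cmod (\<sigma> m k - \<sigma> n k) * sqrt (w k)) S)
              \<longlonglongrightarrow> L2_set (\<lambda>k. cmod (\<sigma> m k - l k) * sqrt (w k)) S"
            unfolding L2_set_def by (intro tendsto_intros l)
          show "\<forall>\<^sub>F n in sequentially.
              L2_set (\<lambda>k. cmod (\<sigma> m k - \<sigma> n k) * sqrt (w k)) S \<le> e / 2"
            using eventually_ge_at_top[of N]
          proof eventually_elim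
            case (elim n)
            show ?case
              using L2_set_le_wnorm[OF w' diff[of m n] S] N[OF \<open>N \<le> m\<close> elim] by simp
          qed
        qed simp
        from wnorm_leI[OF w' this] show ?thesis using e by simp
      qed
      moreover have "\<sigma> m \<in> wball w s" for m using mem by (simp add: wball_def)
      ultimately show "\<forall>\<^sub>F m in sequentially. \<sigma> m \<in> wball w s \<and> wnorm w (\<lambda>k. \<sigma> m k - l k) < e"
        by (auto simp: eventually_sequentially)
    qed
    then show "\<exists>x. limitin mtopology \<sigma> x sequentially" by blast
  qed
qed

lemma wball_contraction_fixpoint:
  assumes w: "\<And>k. 0 < w k" and s: "0 \<le> s" and q: "q < 1"
    and self: "\<And>c. c \<in> wball w s \<Longrightarrow> \<Phi> c \<in> wball w s"
    and contr: "\<And>c b. c \<in> wball w s \<Longrightarrow> b \<in> wball w s \<Longrightarrow>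
      wnorm w (\<lambda>k. \<Phi> c k - \<Phi> b k) \<le> q * wnorm w (\<lambda>k. c k - b k)"
  shows "\<exists>!c. c \<in> wball w s \<and> \<Phi> c = c"
proof -
  interpret Metric_space "wball w s" "\<lambda>c b. wnorm w (\<lambda>k. c k - b k)"
    by (rule Metric_space_wball[OF w])
  have "(\<lambda>k. 0) \<in> wball w s"
    using s by (simp add: wball_def wl2_zero wnorm_zero)
  then obtain c where c: "c \<in> wball w s" "\<Phi> c = c"
    using Banach_fixedpoint_thm[OF mcomplete_wball[OF w], of \<Phi> q] self contr q by blast
  have "b = c" if "b \<in> wball w s" "\<Phi> b = b" for b
  proof -
    let ?n = "wnorm w (\<lambda>k. b k - c k)"
    have "?n \<le> q * ?n" using contr[OF that(1) c(1)] that(2) c(2) by simp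
    moreover have "0 \<le> ?n" by (rule nonneg)
    ultimately have "?n = 0"
      using q mult_right_mono[of q 1 ?n] mult_strict_right_mono[of q 1 ?n] by linarith
    then show ?thesis using zero that c by blast
  qed
  then show ?thesis using c by blast
qed

section \<open>Trigonometric series\<close>

text \<open>Dominated convergence for unordered sums along an arbitrary filter. On the set
  \<open>S\<close> where the domination holds, the Weierstrass M-test makes the finite partial sums
  converge uniformly, so the two limits can be exchanged.\<close>

lemma tendsto_infsum_dominated:
  fixes f :: "'a \<Rightarrow> 'b \<Rightarrow> 'c::banach"
  assumes dom: "\<forall>\<^sub>F x in F. \<forall>k\<in>X. norm (f k x) \<le> g k" and g: "g summable_on X"
    and lim: "\<And>k. k \<in> X \<Longrightarrow> (f k \<longlongrightarrow> l k) F"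
  shows "((\<lambda>x. \<Sum>\<^sub>\<infinity>k\<in>X. f k x) \<longlongrightarrow> (\<Sum>\<^sub>\<infinity>k\<in>X. l k)) F"
proof (cases "F = bot")
  case False
  define S where "S = {x. \<forall>k\<in>X. norm (f k x) \<le> g k}"
  have "norm (l k) \<le> g k" if "k \<in> X" for k
    using dom that False by (intro tendsto_upperbound[OF tendsto_norm[OF lim[OF that]]])
      (auto elim: eventually_mono)
  then have "l summable_on X"
    by (rule abs_summable_summable[OF Infinite_Sum.abs_summable_on_comparison_test'[OF g]])
  show ?thesis
  proof (rule swap_uniform_limit')
    show "uniform_limit S (\<lambda>A x. \<Sum>k\<in>A. f k x) (\<lambda>x. \<Sum>\<^sub>\<infinity>k\<in>X. f k x) (finite_subsets_at_top X)"
      by (rule Weierstrass_m_test_general[OF _ g]) (auto simp: S_def)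
    show "\<forall>\<^sub>F A in finite_subsets_at_top X. ((\<lambda>x. \<Sum>k\<in>A. f k x) \<longlongrightarrow> (\<Sum>k\<in>A. l k)) F"
      by (rule eventually_finite_subsets_at_top_weakI) (auto intro!: tendsto_sum lim)
    show "(sum l \<longlongrightarrow> (\<Sum>\<^sub>\<infinity>k\<in>X. l k)) (finite_subsets_at_top X)"
      using \<open>l summable_on X\<close> by (rule infsum_tendsto)
    show "\<forall>\<^sub>F x in F. x \<in> S" using dom by (simp add: S_def)
  qed simp
qed simp

lemma has_sum_sum:
  fixes f :: "'i \<Rightarrow> 'a \<Rightarrow> 'b::{topological_comm_monoid_add}"
  assumes "\<And>n. n \<in> A \<Longrightarrow> (f n has_sum s n) X"
  shows "((\<lambda>k. \<Sum>n\<in>A. f n k) has_sum (\<Sum>n\<in>A. s n)) X"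
  using assms by (induction A rule: infinite_finite_induct) (auto intro!: has_sum_add)

text \<open>The geometric sum is bounded by \<open>2 / cmod (z - 1)\<close> uniformly in
  \<open>N\<close>, so division by \<open>N\<close> sends the mean to zero.\<close>

lemma power_means_tendsto_0:
  fixes z :: complex
  assumes "cmod z = 1" "z \<noteq> 1"
  shows "(\<lambda>N. (\<Sum>n<N. z ^ n) / of_nat N) \<longlonglongrightarrow> 0"
proof (rule Lim_null_comparison)
  show "\<forall>\<^sub>F N in sequentially. cmod ((\<Sum>n<N. z ^ n) / of_nat N) \<le> (2 / cmod (z - 1)) / real N"
  proof (rule always_eventually, rule allI)
    fix N
    have "cmod (z ^ N - 1) \<le> 2"
      using norm_triangle_ineq4[of "z ^ N" 1] assms by (simp add: norm_power)
    then have "cmod (\<Sum>n<N. z ^ n) \<le> 2 / cmod (z - 1)"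
      using assms by (simp add: geometric_sum norm_divide divide_right_mono)
    from divide_right_mono[OF this, of "real N"]
    show "cmod ((\<Sum>n<N. z ^ n) / of_nat N) \<le> (2 / cmod (z - 1)) / real N"
      by (simp add: norm_divide)
  qed
  show "(\<lambda>N. (2 / cmod (z - 1)) / real N) \<longlonglongrightarrow> 0"
    by (rule tendsto_divide_0[OF tendsto_const filterlim_at_top_imp_at_infinity[OF filterlim_real_sequentially]])
qed

definition kdot :: "int ^ 'd::finite \<Rightarrow> real ^ 'd \<Rightarrow> real" where
  "kdot k x = (\<Sum>j\<in>UNIV. real_of_int (k $ j) * x $ j)"

lemma mode_real_point: "mode k (real_point x) = cis (kdot k x)"
  by (simp add: mode_def real_point_def kdot_def cis_conv_exp)

lemma kdot_diff: "kdot (k - l) x = kdot k x - kdot l x"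
  by (simp add: kdot_def left_diff_distrib sum_subtractf)

lemma kdot_scaleR: "kdot k (a *\<^sub>R x) = a * kdot k x"
  by (simp add: kdot_def sum_distrib_left mult.left_commute)

text \<open>The bad vectors lie on countably many hyperplanes \<open>kdot k x = 2 * pi * n\<close>
  with \<open>k \<noteq> 0\<close>. Each is a null set, so they cannot cover the whole
  space.\<close>

lemma exists_nonresonant_vector:
  "\<exists>\<alpha> :: real ^ 'd::finite. \<forall>k. k \<noteq> 0 \<longrightarrow> cis (kdot k \<alpha>) \<noteq> 1"
proof -
  define H where "H = (\<lambda>(k, n). {x :: real ^ 'd. kdot k x = of_int n * (2 * pi)})"
  have "negligible (H p)" if p_in: "p \<in> {k. k \<noteq> 0} \<times> (UNIV :: int set)" for p
  proof -
    obtain k n where p: "p = (k, n)" "k \<noteq> 0" using p_in by (cases p) auto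
    define a :: "real ^ 'd" where "a = (\<chi> j. real_of_int (k $ j))"
    have "a \<noteq> 0" using p(2) by (auto simp: a_def vec_eq_iff)
    moreover have "H p = {x. a \<bullet> x = of_int n * (2 * pi)}"
      by (simp add: H_def p a_def kdot_def inner_vec_def)
    ultimately show ?thesis by (simp add: negligible_hyperplane)
  qed
  then have "negligible (\<Union> (H ` ({k. k \<noteq> 0} \<times> UNIV)))"
    by (intro negligible_countable_Union) auto
  then have "\<Union> (H ` ({k. k \<noteq> 0} \<times> UNIV)) \<noteq> UNIV"
    using non_negligible_UNIV by metis
  then obtain \<alpha> where \<alpha>: "\<alpha> \<notin> \<Union> (H ` ({k. k \<noteq> 0} \<times> UNIV))" by blast
  have "cis (kdot k \<alpha>) \<noteq> 1" if "k \<noteq> 0" for k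
  proof
    assume "cis (kdot k \<alpha>) = 1"
    then obtain n :: int where "kdot k \<alpha> = of_int (2 * n) * pi"
      unfolding cis_conv_exp exp_eq_1 by auto
    then have "\<alpha> \<in> H (k, n)" by (simp add: H_def)
    then show False using \<alpha> that by blast
  qed
  then show ?thesis by blast
qed

text \<open>
  Averaging the series against a character along the orbit \<open>n\<alpha>\<close> of a nonresonant \<open>\<alpha>\<close>
  isolates a single coefficient, so no integration over the torus is required.
\<close>

lemma trig_series_coeff_eq_0:
  fixes c :: "int ^ 'd::finite \<Rightarrow> complex"
  assumes c: "(\<lambda>k. cmod (c k)) summable_on UNIV"
    and zero: "\<And>x. ((\<lambda>k. c k * mode k (real_point x)) has_sum 0) UNIV"
  shows "c l = 0"
proof -
  obtain \<alpha> :: "real ^ 'd" where \<alpha>: "\<And>k. k \<noteq> 0 \<Longrightarrow> cis (kdot k \<alpha>) \<noteq> 1"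
    using exists_nonresonant_vector by blast
  define z where "z k = cis (kdot (k - l) \<alpha>)" for k
  \<comment> \<open>The term with index \<open>k\<close> in the average, over the first
    \<open>N\<close> orbit points, of the series multiplied by the conjugate character of
    \<open>l\<close>. As \<open>N\<close> grows it tends to \<open>c l\<close> for
    \<open>k = l\<close> and to zero otherwise.\<close>
  define f where "f k N = c k * ((\<Sum>n<N. z k ^ n) / of_nat N)" for k N
  have z: "cmod (z k) = 1" for k by (simp add: z_def)
  have "(f k \<longlongrightarrow> (if k = l then c l else 0)) sequentially" for k
  proof (cases "k = l")
    case True
    then have z1: "z k = 1" by (simp add: z_def kdot_def)
    have "\<forall>\<^sub>F N in sequentially. f k N = c k"
      using eventually_gt_at_top[of "0::nat"] by eventually_elim (simp add: f_def z1)
    then show ?thesis using True by (simp add: tendsto_eventually)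
  next
    case False
    then have "z k \<noteq> 1" using \<alpha>[of "k - l"] by (simp add: z_def)
    then show ?thesis
      using tendsto_mult_right_zero[OF power_means_tendsto_0[OF z], of k "c k"] False
      by (simp add: f_def[abs_def])
  qed
  moreover have "cmod (f k N) \<le> cmod (c k)" for k N
  proof -
    have "cmod (\<Sum>n<N. z k ^ n) \<le> real N"
      using sum_norm_le[of "{..<N}" "\<lambda>n. z k ^ n" "\<lambda>n. 1"] by (simp add: norm_power z)
    \<comment> \<open>For \<open>N = 0\<close> the quotient is zero by the convention on division,
      so the domination holds for every \<open>N\<close>.\<close>
    then have "cmod ((\<Sum>n<N. z k ^ n) / of_nat N) \<le> 1"
      by (cases "N = 0") (simp_all add: norm_divide divide_le_eq_1)
    then show ?thesis
      unfolding f_def norm_mult by (intro mult_left_le) auto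
  qed
  ultimately have "(\<lambda>N. \<Sum>\<^sub>\<infinity>k. f k N) \<longlonglongrightarrow> (\<Sum>\<^sub>\<infinity>k. if k = l then c l else 0)"
    by (intro tendsto_infsum_dominated[OF _ c] always_eventually allI ballI)
  \<comment> \<open>For fixed \<open>N\<close> this is a finite combination of values of the series
    at the points \<open>n * \<alpha>\<close>, all of which vanish.\<close>
  moreover have "(\<Sum>\<^sub>\<infinity>k. f k N) = 0" for N
  proof -
    have "((\<lambda>k. c k * mode k (real_point (real n *\<^sub>R \<alpha>)) * cis (- real n * kdot l \<alpha>)) has_sum 0) UNIV" for n
      using has_sum_cmult_left[OF zero] by simp
    moreover have "mode k (real_point (real n *\<^sub>R \<alpha>)) * cis (- real n * kdot l \<alpha>) = z k ^ n" for k n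
      by (simp add: mode_real_point kdot_scaleR cis_mult z_def kdot_diff Complex.DeMoivre algebra_simps)
    ultimately have "((\<lambda>k. c k * z k ^ n) has_sum 0) UNIV" for n
      by (simp add: mult.assoc)
    then have "((\<lambda>k. (\<Sum>n<N. c k * z k ^ n)) has_sum (\<Sum>n<N. 0)) UNIV"
      by (intro has_sum_sum)
    from has_sum_cmult_left[OF this, of "1 / of_nat N"]
    have "((\<lambda>k. f k N) has_sum 0) UNIV"
      by (simp add: f_def sum_distrib_left)
    then show ?thesis by (rule infsumI)
  qed
  ultimately have "(\<Sum>\<^sub>\<infinity>k. if k = l then c l else 0) = 0"
    by (simp add: LIMSEQ_const_iff)
  moreover have "(\<Sum>\<^sub>\<infinity>k. if k = l then c l else 0) = (\<Sum>\<^sub>\<infinity>k\<in>{l}. c l)"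
    by (rule infsum_cong_neutral) auto
  ultimately show ?thesis by simp
qed

section \<open>Small divisors\<close>

definition eigval :: "real ^ 'd::finite \<Rightarrow> real \<Rightarrow> int ^ 'd \<Rightarrow> real" where
  "eigval \<nu> m k = m - (\<Sum>i\<in>UNIV. (\<nu> $ i)\<^sup>2 * (real_of_int (k $ i))\<^sup>2)"

lemma freq_box_eq_cbox: "freq_box = cbox (\<chi> i. 1) (\<chi> i. 2)"
  by (auto simp: freq_box_def mem_box_cart)

text \<open>The threshold \<open>\<delta>\<close> does not vary with \<open>k\<close>: resonances
  are removed only for the finitely many \<open>low_modes\<close>.\<close>

definition resonant :: "real \<Rightarrow> real \<Rightarrow> int ^ 'd::finite \<Rightarrow> (real ^ 'd) set" where
  "resonant m \<delta> k = {\<nu> \<in> freq_box. \<bar>eigval \<nu> m k\<bar> \<le> \<delta>}"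

lemma compact_resonant: "compact (resonant m \<delta> k)"
proof -
  have "closed {\<nu> :: real ^ 'a. \<bar>eigval \<nu> m k\<bar> \<le> \<delta>}"
    unfolding eigval_def by (intro closed_Collect_le continuous_intros)
  moreover have "resonant m \<delta> k = freq_box \<inter> {\<nu>. \<bar>eigval \<nu> m k\<bar> \<le> \<delta>}"
    by (auto simp: resonant_def)
  ultimately show ?thesis
    by (simp add: freq_box_eq_cbox compact_Int_closed)
qed

text \<open>A shift by \<open>t\<close> in direction \<open>i\<close> changes the eigenvalue by
  \<open>(2 * \<nu> $ i * t + t\<^sup>2) * (k $ i)\<^sup>2\<close>, which is at least
  \<open>2 * t\<close>, while two values in \<open>[-\<delta>, \<delta>]\<close> differ by at most
  \<open>2 * \<delta>\<close>.\<close>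

lemma resonant_fibre_width:
  assumes \<nu>: "\<nu> \<in> resonant m \<delta> k" and \<mu>: "\<mu> \<in> resonant m \<delta> k"
    and shift: "\<mu> = \<nu> + axis i t" and k: "k $ i \<noteq> 0" and t: "0 \<le> t"
  shows "t \<le> \<delta>"
proof -
  have "eigval \<nu> m k - eigval \<mu> m k
      = (\<Sum>j\<in>UNIV. ((\<mu> $ j)\<^sup>2 - (\<nu> $ j)\<^sup>2) * (real_of_int (k $ j))\<^sup>2)"
    by (simp add: eigval_def left_diff_distrib sum_subtractf)
  also have "\<dots> = (\<Sum>j\<in>UNIV. if j = i then ((\<nu> $ i + t)\<^sup>2 - (\<nu> $ i)\<^sup>2) * (real_of_int (k $ i))\<^sup>2 else 0)"
    by (rule sum.cong) (auto simp: shift axis_def)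
  also have "\<dots> = ((\<nu> $ i + t)\<^sup>2 - (\<nu> $ i)\<^sup>2) * (real_of_int (k $ i))\<^sup>2"
    by simp
  finally have eq: "eigval \<nu> m k - eigval \<mu> m k
    = ((\<nu> $ i + t)\<^sup>2 - (\<nu> $ i)\<^sup>2) * (real_of_int (k $ i))\<^sup>2" .
  have "1 \<le> \<nu> $ i" using \<nu> by (simp add: resonant_def freq_box_def)
  then have "t * 2 \<le> t * (2 * \<nu> $ i + t)"
    using t by (intro mult_left_mono) auto
  then have "2 * t \<le> (\<nu> $ i + t)\<^sup>2 - (\<nu> $ i)\<^sup>2"
    by (simp add: power2_eq_square algebra_simps)
  moreover have "1 \<le> (real_of_int (k $ i))\<^sup>2"
  proof -
    have "1 \<le> \<bar>k $ i\<bar>" using k by linarith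
    then have "1 \<le> \<bar>real_of_int (k $ i)\<bar>" by linarith
    then show ?thesis by (simp add: abs_le_square_iff[of 1, simplified])
  qed
  ultimately have "2 * t * 1 \<le> ((\<nu> $ i + t)\<^sup>2 - (\<nu> $ i)\<^sup>2) * (real_of_int (k $ i))\<^sup>2"
    using t by (intro mult_mono) auto
  moreover have "eigval \<nu> m k - eigval \<mu> m k \<le> 2 * \<delta>"
    using \<nu> \<mu> by (auto simp: resonant_def)
  ultimately show ?thesis using eq by linarith
qed

text \<open>
  The translates of the resonant set by multiples of \<open>2\<delta>\<close> in a direction \<open>i\<close> with \<open>k\<^sub>i \<noteq> 0\<close>
  are disjoint, and about \<open>1 / (2\<delta>)\<close> of them fit into a fixed box.
\<close>

lemma measure_resonant_le:
  fixes k :: "int ^ 'd::finite"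
  assumes "k \<noteq> 0" and \<delta>: "0 < \<delta>" "\<delta> < 1 / 2"
  shows "measure lebesgue (resonant m \<delta> k) \<le> 4 * 2 ^ CARD('d) * \<delta>"
proof -
  obtain i where i: "k $ i \<noteq> 0" using assms(1) by (auto simp: vec_eq_iff)
  \<comment> \<open>With this many translates, no shift \<open>2 * \<delta> * n\<close> with
    \<open>n < J\<close> exceeds 1.\<close>
  define J where "J = nat \<lfloor>1 / (2 * \<delta>)\<rfloor>"
  define R where "R = resonant m \<delta> k"
  define T where "T n = (+) (axis i (2 * \<delta> * real n)) ` R" for n :: nat
  \<comment> \<open>The frequencies lie in \<open>[1,2]\<close> and the shifts in
    \<open>[0,1]\<close>, so side length 2 suffices; this is the source of the factor
    \<open>2 ^ CARD('d)\<close>.\<close>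
  define Q :: "(real ^ 'd) set" where "Q = cbox (\<chi> i. 1) (\<chi> i. 3)"
  have R: "R \<in> lmeasurable" "R \<subseteq> freq_box"
    using compact_resonant lmeasurable_compact by (auto simp: R_def resonant_def)
  have T: "T n \<in> lmeasurable" "measure lebesgue (T n) = measure lebesgue R" for n
    using R by (simp_all add: T_def measurable_translation measure_translation)
  \<comment> \<open>A common point would give two resonant vectors differing by at least
    \<open>2 * \<delta>\<close> along axis \<open>i\<close>, more than the fibre width
    \<open>\<delta>\<close> permits.\<close>
  have disj: "T n \<inter> T p = {}" if "n < p" for n p
  proof (rule ccontr)
    assume "T n \<inter> T p \<noteq> {}"
    then obtain \<nu> \<mu> where *: "\<nu> \<in> R" "\<mu> \<in> R"
      "axis i (2 * \<delta> * real n) + \<mu> = axis i (2 * \<delta> * real p) + \<nu>"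
      by (auto simp: T_def)
    then have "\<mu> = \<nu> + (axis i (2 * \<delta> * real p) - axis i (2 * \<delta> * real n))"
      by (simp add: algebra_simps)
    also have "axis i (2 * \<delta> * real p) - axis i (2 * \<delta> * real n) = axis i (2 * \<delta> * (real p - real n))"
      by (simp add: vec_eq_iff axis_def algebra_simps)
    finally have "2 * \<delta> * (real p - real n) \<le> \<delta>"
      using * \<delta> that i by (intro resonant_fibre_width[of \<nu> m \<delta> k \<mu> i]) (auto simp: R_def)
    moreover have "2 * \<delta> * 1 \<le> 2 * \<delta> * (real p - real n)"
      using that \<delta> by (intro mult_left_mono) auto
    ultimately show False using \<delta> by simp
  qed
  have sub: "T n \<subseteq> Q" if "n < J" for n
  proof -
    have "real n \<le> 1 / (2 * \<delta>)" using that \<delta> unfolding J_def by linarith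
    then have "2 * \<delta> * real n \<le> 1" using \<delta> by (simp add: field_simps)
    moreover have "0 \<le> 2 * \<delta> * real n" using \<delta> by simp
    ultimately have "axis i (2 * \<delta> * real n) + \<nu> \<in> Q" if "\<nu> \<in> R" for \<nu>
    proof -
      have "1 \<le> axis i (2 * \<delta> * real n) $ j + \<nu> $ j \<and> axis i (2 * \<delta> * real n) $ j + \<nu> $ j \<le> 3" for j
      proof -
        have "1 \<le> \<nu> $ j" "\<nu> $ j \<le> 2" using that R(2) by (auto simp: freq_box_def)
        moreover have "0 \<le> axis i (2 * \<delta> * real n) $ j" "axis i (2 * \<delta> * real n) $ j \<le> 1"
          using \<open>2 * \<delta> * real n \<le> 1\<close> \<open>0 \<le> 2 * \<delta> * real n\<close> by (simp_all add: axis_def)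
        ultimately show ?thesis by linarith
      qed
      then show ?thesis by (simp add: Q_def mem_box_cart)
    qed
    then show ?thesis by (auto simp: T_def)
  qed
  \<comment> \<open>Since \<open>\<delta> < 1 / 2\<close>, the floor defining \<open>J\<close> is at
    least 1, and rounding down loses at most a factor 2. This is the source of the constant
    4.\<close>
  have J: "1 / (4 * \<delta>) \<le> real J"
  proof -
    have "1 \<le> 1 / (2 * \<delta>)" using \<delta> by (simp add: field_simps)
    then have "1 \<le> \<lfloor>1 / (2 * \<delta>)\<rfloor>" by (simp only: one_le_floor)
    then have "real J = of_int \<lfloor>1 / (2 * \<delta>)\<rfloor>" "1 \<le> real J"
      unfolding J_def by linarith+
    then have "1 / (2 * \<delta>) \<le> 2 * real J"
      using real_of_int_floor_add_one_gt[of "1 / (2 * \<delta>)"] by linarith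
    then show ?thesis by (simp add: field_simps)
  qed
  have "1 / (4 * \<delta>) * measure lebesgue R \<le> real J * measure lebesgue R"
    using J by (intro mult_right_mono) auto
  also have "\<dots> = (\<Sum>n<J. measure lebesgue (T n))" by (simp add: T)
  also have "\<dots> = measure lebesgue (\<Union>n<J. T n)"
  proof (rule measure_finite_Union[symmetric])
    show "disjoint_family_on T {..<J}"
      using disj by (auto simp: disjoint_family_on_def) (metis Int_iff empty_iff linorder_neqE_nat)
    show "emeasure lebesgue (T n) \<noteq> \<infinity>" if "n \<in> {..<J}" for n
      using T(1)[of n] by (auto simp: fmeasurable_def)
  qed (use T in \<open>auto simp: fmeasurable_def\<close>)
  also have "\<dots> \<le> measure lebesgue Q"
    using sub T(1) by (intro measure_mono_fmeasurable) (auto simp: Q_def fmeasurableD)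
  also have "\<dots> = 2 ^ CARD('d)"
    by (simp add: Q_def content_cbox_cart interval_ne_empty_cart prod_constant)
  finally show ?thesis
    using \<delta> by (simp add: R_def field_simps)
qed

section \<open>Ellipticity outside a finite set of modes and the measure of the excluded set\<close>

lemma l1_nonneg: "0 \<le> l1 k"
  by (simp add: l1_def sum_nonneg)

lemma abs_component_le_l1: "\<bar>real_of_int (k $ i)\<bar> \<le> l1 k"
  unfolding l1_def by (rule member_le_sum) auto

lemma finite_l1_le: "finite {k :: int ^ 'd::finite. l1 k \<le> B}"
proof (rule finite_subset)
  have "\<bar>k $ j\<bar> \<le> \<lfloor>B\<rfloor>" if "l1 k \<le> B" for k :: "int ^ 'd" and j
    using abs_component_le_l1[of k j] that by linarith
  then show "{k :: int ^ 'd. l1 k \<le> B} \<subseteq> vec_lambda ` (UNIV \<rightarrow>\<^sub>E {- \<lfloor>B\<rfloor>..\<lfloor>B\<rfloor>})"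
    by (auto intro!: image_eqI[of _ _ "vec_nth _"] simp: abs_le_iff minus_le_iff) 
  show "finite (vec_lambda ` ((UNIV :: 'd set) \<rightarrow>\<^sub>E {- \<lfloor>B\<rfloor>..\<lfloor>B\<rfloor>}))"
    by (intro finite_imageI finite_PiE) auto
qed

lemma l1_ge_1: "k \<noteq> 0 \<Longrightarrow> 1 \<le> l1 k"
proof -
  assume "k \<noteq> 0"
  then obtain i where "k $ i \<noteq> 0" by (auto simp: vec_eq_iff)
  then have "1 \<le> \<bar>real_of_int (k $ i)\<bar>" by linarith
  also have "\<dots> \<le> l1 k" by (rule abs_component_le_l1)
  finally show ?thesis .
qed

text \<open>Cauchy-Schwarz bounds \<open>(l1 k)\<^sup>2\<close> by the dimension times the sum of
  the \<open>(k $ i)\<^sup>2\<close>, and \<open>\<nu> $ i \<ge> 1\<close> bounds that sum by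
  \<open>m - eigval \<nu> m k\<close>. The hypothesis on \<open>k\<close> then absorbs
  \<open>m\<close> into half of the resulting lower bound.\<close>

lemma eigval_elliptic:
  fixes k :: "int ^ 'd::finite"
  assumes \<nu>: "\<nu> \<in> freq_box" and k: "2 * real CARD('d) * m < (l1 k)\<^sup>2"
  shows "(l1 k)\<^sup>2 / (2 * real CARD('d)) \<le> - eigval \<nu> m k"
proof -
  have "(l1 k)\<^sup>2 \<le> real CARD('d) * (\<Sum>i\<in>UNIV. (real_of_int (k $ i))\<^sup>2)"
    using sum_squared_le_sum_of_squares[of "\<lambda>i. \<bar>real_of_int (k $ i)\<bar>"]
    by (simp add: l1_def mult.commute)
  also have "(\<Sum>i\<in>UNIV. (real_of_int (k $ i))\<^sup>2) \<le> (\<Sum>i\<in>UNIV. (\<nu> $ i)\<^sup>2 * (real_of_int (k $ i))\<^sup>2)"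
  proof (rule sum_mono)
    fix i
    have "1 \<le> (\<nu> $ i)\<^sup>2" using \<nu> by (simp add: freq_box_def one_le_power)
    then show "(real_of_int (k $ i))\<^sup>2 \<le> (\<nu> $ i)\<^sup>2 * (real_of_int (k $ i))\<^sup>2"
      using mult_right_mono[of 1 "(\<nu> $ i)\<^sup>2" "(real_of_int (k $ i))\<^sup>2"] by simp
  qed
  finally have "(l1 k)\<^sup>2 \<le> real CARD('d) * (m - eigval \<nu> m k)"
    by (simp add: eigval_def mult_left_mono)
  then have "(l1 k)\<^sup>2 / real CARD('d) \<le> m - eigval \<nu> m k"
    by (simp add: field_simps)
  moreover have "m \<le> (l1 k)\<^sup>2 / (2 * real CARD('d))"
    using k by (simp add: field_simps)
  moreover have "(l1 k)\<^sup>2 / real CARD('d) = 2 * ((l1 k)\<^sup>2 / (2 * real CARD('d)))"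
    by simp
  ultimately show ?thesis by linarith
qed

text \<open>The nonzero modes outside the range of \<open>eigval_elliptic\<close>. Zero is left out
  because its eigenvalue is \<open>m\<close> for every \<open>\<nu>\<close>.\<close>

definition low_modes :: "real \<Rightarrow> (int ^ 'd::finite) set" where
  "low_modes m = {k. k \<noteq> 0 \<and> (l1 k)\<^sup>2 \<le> 2 * real CARD('d) * m}"

lemma finite_low_modes: "finite (low_modes m)"
proof -
  have "l1 k \<le> sqrt (2 * real CARD('a) * m)" if "k \<in> low_modes m" for k :: "int ^ 'a"
    using that by (auto simp: low_modes_def intro: real_le_rsqrt)
  then have "low_modes m \<subseteq> {k :: int ^ 'a. l1 k \<le> sqrt (2 * real CARD('a) * m)}" by blast
  then show ?thesis using finite_l1_le finite_subset by blast
qed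

text \<open>The constant is uniform over all nonresonant \<open>\<nu>\<close>, which later makes the
  threshold for \<open>\<epsilon>\<close> uniform as well.\<close>

lemma eigval_lower_bound:
  fixes m \<delta> :: real
  assumes m: "0 < m" and \<delta>: "0 < \<delta>"
  shows "\<exists>c>0. \<forall>\<nu> \<in> freq_box - (\<Union>k\<in>low_modes m. resonant m \<delta> k).
    \<forall>k :: int ^ 'd::finite. c * (1 + (l1 k)\<^sup>2) \<le> \<bar>eigval \<nu> m k\<bar>"
proof -
  let ?D = "2 * real CARD('d)"
  \<comment> \<open>One candidate per regime: the zero mode; the low modes, where
    \<open>1 + (l1 k)\<^sup>2 \<le> 1 + ?D * m\<close>; and the elliptic modes, where
    \<open>1 + (l1 k)\<^sup>2 \<le> 2 * (l1 k)\<^sup>2\<close>.\<close>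
  define c where "c = Min {m, \<delta> / (1 + ?D * m), 1 / (2 * ?D)}"
  have c: "0 < c" "c \<le> m" "c \<le> \<delta> / (1 + ?D * m)" "c \<le> 1 / (2 * ?D)"
    using m \<delta> by (auto simp: c_def intro!: divide_pos_pos add_pos_nonneg)
  have "c * (1 + (l1 k)\<^sup>2) \<le> \<bar>eigval \<nu> m k\<bar>"
    if \<nu>: "\<nu> \<in> freq_box" "\<nu> \<notin> (\<Union>k\<in>low_modes m. resonant m \<delta> k)" for \<nu> and k :: "int ^ 'd"
  proof -
    consider "k = 0" | "k \<in> low_modes m" | "k \<noteq> 0" "?D * m < (l1 k)\<^sup>2"
      by (force simp: low_modes_def)
    then show ?thesis
    proof cases
      case 1
      then show ?thesis using c m by (simp add: l1_def eigval_def)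
    next
      case 2
      then have "\<delta> < \<bar>eigval \<nu> m k\<bar>" using \<nu> by (auto simp: resonant_def)
      moreover have "c * (1 + (l1 k)\<^sup>2) \<le> \<delta> / (1 + ?D * m) * (1 + ?D * m)"
        using c 2 \<delta> m by (intro mult_mono) (auto simp: low_modes_def)
      moreover have "1 + ?D * m \<noteq> 0" using m by (smt (verit) of_nat_0_le_iff mult_nonneg_nonneg)
      ultimately show ?thesis by simp
    next
      case 3
      have "1 \<le> (l1 k)\<^sup>2" using l1_ge_1[OF 3(1)] by (simp add: one_le_power)
      then have "c * (1 + (l1 k)\<^sup>2) \<le> 1 / (2 * ?D) * (2 * (l1 k)\<^sup>2)"
        using c by (intro mult_mono) auto
      also have "\<dots> = (l1 k)\<^sup>2 / ?D" by simp
      also have "\<dots> \<le> - eigval \<nu> m k" using eigval_elliptic[OF \<nu>(1) 3(2)] .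
      finally show ?thesis by linarith
    qed
  qed
  then show ?thesis using c(1) by blast
qed

text \<open>Subadditivity over the low modes, whose number depends on \<open>m\<close> and the
  dimension but not on \<open>\<delta>\<close>; hence the bound is linear in
  \<open>\<delta>\<close>.\<close>

lemma measure_resonant_union_le:
  assumes "0 < \<delta>" "\<delta> < 1 / 2"
  shows "measure lebesgue (\<Union>k\<in>low_modes m. resonant m \<delta> k :: (real ^ 'd::finite) set)
    \<le> real (card (low_modes m :: (int ^ 'd) set)) * (4 * 2 ^ CARD('d)) * \<delta>"
proof -
  have "measure lebesgue (\<Union>k\<in>low_modes m. resonant m \<delta> k :: (real ^ 'd) set)
      \<le> (\<Sum>k\<in>(low_modes m :: (int ^ 'd) set). measure lebesgue (resonant m \<delta> k))"
    by (intro measure_UNION_le finite_low_modes)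
      (use lmeasurable_compact[OF compact_resonant] in \<open>auto simp: fmeasurable_def\<close>)
  also have "\<dots> \<le> (\<Sum>k\<in>(low_modes m :: (int ^ 'd) set). 4 * 2 ^ CARD('d) * \<delta>)"
    by (intro sum_mono measure_resonant_le assms) (auto simp: low_modes_def)
  finally show ?thesis by simp
qed

section \<open>Term-by-term differentiation\<close>

lemma summable_on_int_powr:
  assumes "s < - 1"
  shows "(\<lambda>n::int. (1 + \<bar>real_of_int n\<bar>) powr s) summable_on UNIV"
proof -
  have sm: "summable (\<lambda>n. real (n + a) powr s)" for a
    using assms by (subst summable_iff_shift[of "\<lambda>n. real n powr s"]) (simp add: summable_real_powr_iff)
  \<comment> \<open>The offset \<open>a\<close> is 1 along the nonnegative integers
    \<open>int n\<close> and 2 along the negative ones \<open>- int n - 1\<close>.\<close>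
  have half: "(\<lambda>n::int. (1 + \<bar>real_of_int n\<bar>) powr s) summable_on range h"
    if "inj h" "\<And>n. 1 + \<bar>real_of_int (h n)\<bar> = real (n + a)" for h :: "nat \<Rightarrow> int" and a
    using sm[of a] that
    by (subst summable_on_reindex) (auto intro!: summable_nonneg_imp_summable_on simp: o_def)
  have "(UNIV :: int set) = range int \<union> range (\<lambda>n. - int n - 1)"
  proof -
    have "n \<in> range int \<union> range (\<lambda>n. - int n - 1)" for n
    proof (cases "0 \<le> n")
      case True
      then show ?thesis by (metis UnI1 nonneg_int_cases rangeI)
    next
      case False
      then have "n = - int (nat (- n - 1)) - 1" by simp
      then show ?thesis by blast
    qed
    then show ?thesis by blast
  qed
  moreover have "(\<lambda>n::int. (1 + \<bar>real_of_int n\<bar>) powr s) summable_on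
      (range int \<union> range (\<lambda>n. - int n - 1))"
    by (intro summable_on_Un_disjoint half[of _ 1] half[of _ 2]) (auto simp: inj_def)
  ultimately show ?thesis by simp
qed

text \<open>A finite set of vectors is contained in the product of its coordinate projections, over
  which the sum of products factors into one-dimensional sums.\<close>

lemma summable_on_prod_vec:
  fixes a :: "'b \<Rightarrow> real"
  assumes a: "a summable_on UNIV" and nonneg: "\<And>n. 0 \<le> a n"
  shows "(\<lambda>k :: 'b ^ 'd::finite. \<Prod>i\<in>UNIV. a (k $ i)) summable_on UNIV"
proof (rule nonneg_bdd_above_summable_on)
  show "bdd_above (sum (\<lambda>k :: 'b ^ 'd. \<Prod>i\<in>UNIV. a (k $ i)) ` {F. F \<subseteq> UNIV \<and> finite F})"
  proof (rule bdd_aboveI2)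
    fix S :: "('b ^ 'd) set" assume "S \<in> {F. F \<subseteq> UNIV \<and> finite F}"
    then have S: "finite S" by simp
    define T where "T i = (\<lambda>k. k $ i) ` S" for i :: 'd
    have T: "finite (T i)" for i using S by (simp add: T_def)
    have "(\<Sum>k\<in>S. \<Prod>i\<in>UNIV. a (k $ i)) = (\<Sum>g\<in>vec_nth ` S. \<Prod>i\<in>UNIV. a (g i))"
      by (subst sum.reindex) (auto simp: inj_on_def vec_nth_inject)
    also have "\<dots> \<le> (\<Sum>g\<in>PiE UNIV T. \<Prod>i\<in>UNIV. a (g i))"
      using T by (intro sum_mono2 finite_PiE) (auto simp: T_def intro!: prod_nonneg nonneg)
    also have "\<dots> = (\<Prod>i\<in>UNIV. \<Sum>n\<in>T i. a n)"
      using T by (intro prod_sum_PiE[symmetric]) auto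
    also have "\<dots> \<le> (\<Prod>i\<in>(UNIV :: 'd set). \<Sum>\<^sub>\<infinity>n. a n)"
      using T nonneg by (intro prod_mono conjI sum_nonneg finite_sum_le_infsum a) auto
    finally show "(\<Sum>k\<in>S. \<Prod>i\<in>UNIV. a (k $ i)) \<le> (\<Prod>i\<in>(UNIV :: 'd set). \<Sum>\<^sub>\<infinity>n. a n)" .
  qed
qed (simp add: prod_nonneg nonneg)

lemma summable_on_inverse_l1_power:
  assumes p: "CARD('d) < 2 * p"
  shows "(\<lambda>k :: int ^ 'd::finite. 1 / (1 + (l1 k)\<^sup>2) ^ p) summable_on UNIV"
proof -
  \<comment> \<open>This \<open>s\<close> exceeds 1, so the one-dimensional sums converge, and
    \<open>s * CARD('d) = CARD('d) + 1\<close>, which is at most \<open>2 * p\<close> by the strict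
    inequality between integers.\<close>
  define s where "s = 1 + 1 / real CARD('d)"
  define b where "b = (\<lambda>k :: int ^ 'd. 2 ^ p * (\<Prod>i\<in>UNIV. (1 + \<bar>real_of_int (k $ i)\<bar>) powr (- s)))"
  have "b summable_on UNIV"
    unfolding b_def
    by (intro summable_on_cmult_right summable_on_prod_vec summable_on_int_powr) (auto simp: s_def)
  moreover have "1 / (1 + (l1 k)\<^sup>2) ^ p \<le> b k" for k :: "int ^ 'd"
  proof -
    define x where "x = 1 + l1 k"
    have x: "1 \<le> x" using l1_nonneg by (simp add: x_def)
    have "(\<Prod>i\<in>UNIV. (1 + \<bar>real_of_int (k $ i)\<bar>) powr s) \<le> (\<Prod>i\<in>(UNIV :: 'd set). x powr s)"
    proof (intro prod_mono conjI powr_mono2)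
      show "1 + \<bar>real_of_int (k $ i)\<bar> \<le> x" for i
        by (simp add: x_def abs_component_le_l1)
    qed (auto simp: s_def)
    also have "\<dots> = x powr (s * real CARD('d))"
      using x by (simp add: powr_realpow[symmetric] powr_powr)
    also have "s * real CARD('d) = real (CARD('d) + 1)"
      by (simp add: s_def field_simps)
    also have "x powr \<dots> = x ^ (CARD('d) + 1)"
      using x by (intro powr_realpow) auto
    also have "\<dots> \<le> x ^ (2 * p)"
      using x p by (intro power_increasing) auto
    also have "\<dots> = (x\<^sup>2) ^ p" by (simp add: power_mult)
    also have "\<dots> \<le> (2 * (1 + (l1 k)\<^sup>2)) ^ p"
    proof (rule power_mono)
      have "0 \<le> (1 - l1 k)\<^sup>2" by simp
      then show "x\<^sup>2 \<le> 2 * (1 + (l1 k)\<^sup>2)"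
        by (simp add: x_def power2_eq_square algebra_simps)
    qed simp
    finally have le: "(\<Prod>i\<in>UNIV. (1 + \<bar>real_of_int (k $ i)\<bar>) powr s) \<le> 2 ^ p * (1 + (l1 k)\<^sup>2) ^ p"
      unfolding power_mult_distrib .
    have pos: "0 < (\<Prod>i\<in>UNIV. (1 + \<bar>real_of_int (k $ i)\<bar>) powr s)"
      by (intro prod_pos) (auto simp: add_pos_nonneg)
    have "1 / (2 ^ p * (1 + (l1 k)\<^sup>2) ^ p) \<le> 1 / (\<Prod>i\<in>UNIV. (1 + \<bar>real_of_int (k $ i)\<bar>) powr s)"
      using le pos by (intro divide_left_mono) (auto intro: mult_pos_pos less_le_trans)
    also have "\<dots> = (\<Prod>i\<in>UNIV. (1 + \<bar>real_of_int (k $ i)\<bar>) powr (- s))"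
      by (simp add: powr_minus prod_inversef[symmetric] divide_inverse o_def)
    finally have "2 ^ p * (1 / (2 ^ p * (1 + (l1 k)\<^sup>2) ^ p)) \<le> b k"
      unfolding b_def by (intro mult_left_mono) auto
    then show ?thesis by simp
  qed
  ultimately show ?thesis
    by (rule summable_on_comparison_test) auto
qed

section \<open>Differentiation of trigonometric series along the real torus\<close>

lemma cmod_cis_diff_1_le: "cmod (cis t - 1) \<le> \<bar>t\<bar>"
  using dist_exp_i_1[of t] abs_sin_x_le_abs_x[of "t / 2"] by (simp add: cis_conv_exp)

lemma cis_difference_quotient_tendsto:
  "((\<lambda>h. (cis (n * h) - 1) / complex_of_real h - \<i> * of_real n) \<longlongrightarrow> 0) (at 0)"
proof -
  have "((\<lambda>z. exp (\<i> * of_real n * z)) has_field_derivative \<i> * of_real n) (at 0)"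
    by (auto intro!: derivative_eq_intros)
  then have "((\<lambda>z. (exp (\<i> * of_real n * z) - 1) / z) \<longlongrightarrow> \<i> * of_real n) (at 0)"
    by (simp add: DERIV_def)
  moreover have "filterlim complex_of_real (at 0) (at 0)"
    by (auto simp: filterlim_at eventually_at_filter intro!: tendsto_eq_intros)
  ultimately have "((\<lambda>h. (exp (\<i> * of_real n * of_real h) - 1) / complex_of_real h) \<longlongrightarrow> \<i> * of_real n) (at 0)"
    by (rule filterlim_compose)
  then show ?thesis
    by (simp add: cis_conv_exp LIM_zero mult.assoc)
qed

lemma real_point_add_axis:
  "real_point x + axis i (complex_of_real t) = real_point (x + axis i t)"
  by (simp add: vec_eq_iff real_point_def axis_def)

lemma kdot_add_axis: "kdot k (x + axis i t) = kdot k x + real_of_int (k $ i) * t"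
proof -
  have "kdot k (x + axis i t)
      = kdot k x + (\<Sum>j\<in>UNIV. if j = i then real_of_int (k $ i) * t else 0)"
    unfolding kdot_def sum.distrib[symmetric]
    by (rule sum.cong) (auto simp: axis_def algebra_simps)
  then show ?thesis by simp
qed

lemma norm_mode_real_point: "cmod (mode k (real_point x)) = 1"
  by (simp add: mode_real_point)

lemma trig_series_has_sum:
  assumes "(\<lambda>k. cmod (c k)) summable_on UNIV"
  shows "((\<lambda>k. c k * mode k (real_point x)) has_sum (\<Sum>\<^sub>\<infinity>k. c k * mode k (real_point x))) UNIV"
proof -
  have "(\<lambda>k. c k * mode k (real_point x)) summable_on UNIV"
    by (rule abs_summable_summable) (use assms in \<open>simp add: norm_mult norm_mode_real_point\<close>)
  then show ?thesis by simp
qed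

text \<open>Dominated convergence is applied to the errors \<open>e k h\<close> between difference
  quotients and formal derivatives of the terms, with majorant
  \<open>2 * (l1 k * cmod (c k))\<close>. Only values at real points enter, so the case
  \<open>\<rho> = 0\<close> is covered.\<close>

lemma partial_deriv_trig_series:
  fixes c :: "int ^ 'd::finite \<Rightarrow> complex"
  assumes c: "(\<lambda>k. cmod (c k)) summable_on UNIV"
    and c1: "(\<lambda>k. l1 k * cmod (c k)) summable_on UNIV"
    and u: "\<And>x. u (real_point x) = (\<Sum>\<^sub>\<infinity>k. c k * mode k (real_point x))"
  shows "partial_deriv i u (real_point x)
    = (\<Sum>\<^sub>\<infinity>k. \<i> * of_int (k $ i) * c k * mode k (real_point x))"
proof -
  define D where "D = (\<Sum>\<^sub>\<infinity>k. \<i> * of_int (k $ i) * c k * mode k (real_point x))"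
  define e where "e k h = c k * mode k (real_point x) *
    ((cis (real_of_int (k $ i) * h) - 1) / complex_of_real h - \<i> * of_real (real_of_int (k $ i)))" for k h
  have "cmod (e k h) \<le> 2 * (l1 k * cmod (c k))" for k h
  proof -
    \<comment> \<open>At \<open>h = 0\<close> the quotient is zero by the convention on division, so
      the bound holds without restricting \<open>h\<close>.\<close>
    have "cmod ((cis (real_of_int (k $ i) * h) - 1) / complex_of_real h) \<le> \<bar>real_of_int (k $ i)\<bar>"
    proof (cases "h = 0")
      case False
      then show ?thesis
        using cmod_cis_diff_1_le[of "real_of_int (k $ i) * h"]
        by (simp add: norm_divide divide_le_eq abs_mult)
    qed simp
    then have "cmod ((cis (real_of_int (k $ i) * h) - 1) / complex_of_real h - \<i> * of_real (real_of_int (k $ i)))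
        \<le> 2 * l1 k"
      using abs_component_le_l1[of k i] by (intro order_trans[OF norm_triangle_ineq4]) (simp add: norm_mult)
    then have "cmod (c k) * cmod ((cis (real_of_int (k $ i) * h) - 1) / complex_of_real h - \<i> * of_real (real_of_int (k $ i)))
        \<le> cmod (c k) * (2 * l1 k)"
      by (intro mult_left_mono) auto
    then show ?thesis
      by (simp add: e_def norm_mult norm_mode_real_point mult_ac)
  qed
  moreover have "(e k \<longlongrightarrow> 0) (at 0)" for k
    unfolding e_def by (intro tendsto_mult_right_zero cis_difference_quotient_tendsto)
  ultimately have "((\<lambda>h. \<Sum>\<^sub>\<infinity>k. e k h) \<longlongrightarrow> (\<Sum>\<^sub>\<infinity>k::int ^ 'd. 0)) (at 0)"
    by (intro tendsto_infsum_dominated[OF _ summable_on_cmult_right[OF c1]] always_eventually allI ballI)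
  then have lim: "((\<lambda>h. cmod (\<Sum>\<^sub>\<infinity>k. e k h)) \<longlongrightarrow> 0) (at 0)"
    by (simp add: tendsto_norm_zero)
  have D: "((\<lambda>k. \<i> * of_int (k $ i) * c k * mode k (real_point x)) has_sum D) UNIV"
  proof -
    have "cmod (\<i> * of_int (k $ i) * c k) \<le> l1 k * cmod (c k)" for k
      using abs_component_le_l1[of k] by (simp add: norm_mult mult_right_mono)
    then have "(\<lambda>k. cmod (\<i> * of_int (k $ i) * c k)) summable_on UNIV"
      by (intro summable_on_comparison_test[OF c1]) auto
    from trig_series_has_sum[OF this] show ?thesis by (simp add: D_def)
  qed
  have e: "(\<Sum>\<^sub>\<infinity>k. e k h)
      = (u (real_point (x + axis i h)) - u (real_point x)) / complex_of_real h - D" for h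
  proof (rule infsumI)
    have "((\<lambda>k. (c k * mode k (real_point (x + axis i h)) + - (c k * mode k (real_point x))) * (1 / complex_of_real h)
          + - (\<i> * of_int (k $ i) * c k * mode k (real_point x)))
        has_sum ((u (real_point (x + axis i h)) + - u (real_point x)) * (1 / complex_of_real h) + - D)) UNIV"
      unfolding u
      by (intro has_sum_add has_sum_cmult_left, simp_all only: has_sum_uminus minus_minus)
        (rule D trig_series_has_sum[OF c])+
    moreover have "(c k * mode k (real_point (x + axis i h)) + - (c k * mode k (real_point x))) * (1 / complex_of_real h)
          + - (\<i> * of_int (k $ i) * c k * mode k (real_point x)) = e k h" for k
      by (simp add: e_def mode_real_point kdot_add_axis cis_mult[symmetric] diff_divide_distrib right_diff_distrib)
    ultimately show "((\<lambda>k. e k h) has_sum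
        ((u (real_point (x + axis i h)) - u (real_point x)) / complex_of_real h - D)) UNIV"
      by simp
  qed
  have "((\<lambda>t. u (real_point (x + axis i t))) has_vector_derivative D) (at 0)"
    unfolding has_vector_derivative_def has_derivative_at
  proof (intro conjI bounded_linear_scaleR_left)
    have "\<forall>\<^sub>F h in at 0. cmod (\<Sum>\<^sub>\<infinity>k. e k h) = norm (u (real_point (x + axis i (0 + h)))
        - u (real_point (x + axis i 0)) - h *\<^sub>R D) / norm h"
      unfolding eventually_at_filter
    proof (intro always_eventually allI impI)
      fix h :: real assume "h \<noteq> 0"
      then have "(u (real_point (x + axis i h)) - u (real_point x)) / complex_of_real h - D
          = (u (real_point (x + axis i h)) - u (real_point x) - h *\<^sub>R D) / complex_of_real h"
        by (simp add: diff_divide_distrib scaleR_conv_of_real)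
      moreover have ax: "x + axis i 0 = x" by (simp add: vec_eq_iff axis_def)
      ultimately show "cmod (\<Sum>\<^sub>\<infinity>k. e k h) = norm (u (real_point (x + axis i (0 + h)))
        - u (real_point (x + axis i 0)) - h *\<^sub>R D) / norm h"
        unfolding add_0 ax by (simp add: e norm_divide)
    qed
    from Lim_transform_eventually[OF lim this]
    show "(\<lambda>h. norm (u (real_point (x + axis i (0 + h)))
        - u (real_point (x + axis i 0)) - h *\<^sub>R D) / norm h) \<midarrow>0\<rightarrow> 0" .
  qed
  then show ?thesis
    unfolding partial_deriv_def real_point_add_axis D_def by (rule vector_derivative_at)
qed

text \<open>The weight \<open>1 + (l1 k)\<^sup>2\<close> dominates every factor produced by up to
  two differentiations, so all series involved converge absolutely. Multiplying twice by
  \<open>\<i> * k $ i\<close> gives \<open>- (k $ i)\<^sup>2\<close>, hence the symbol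
  \<open>eigval\<close>.\<close>

lemma L_op_trig_series:
  fixes c :: "int ^ 'd::finite \<Rightarrow> complex"
  assumes c: "(\<lambda>k. cmod (c k) * (1 + (l1 k)\<^sup>2)) summable_on UNIV"
    and u: "\<And>x. u (real_point x) = (\<Sum>\<^sub>\<infinity>k. c k * mode k (real_point x))"
  shows "((\<lambda>k. of_real (eigval \<nu> m k) * c k * mode k (real_point x)) has_sum
    L_op \<nu> m u (real_point x)) UNIV"
proof -
  have l1sq: "l1 k \<le> 1 + (l1 k)\<^sup>2" for k :: "int ^ 'd"
  proof -
    have "0 \<le> (l1 k - 1)\<^sup>2" by simp
    then have "2 * l1 k \<le> 1 + (l1 k)\<^sup>2" by (simp add: power2_eq_square algebra_simps)
    then show ?thesis using l1_nonneg[of k] by linarith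
  qed
  have comp: "f summable_on UNIV"
    if "\<And>k. 0 \<le> f k" "\<And>k. f k \<le> cmod (c k) * (1 + (l1 k)\<^sup>2)" for f
    using that by (intro summable_on_comparison_test[OF c]) auto
  have c0: "(\<lambda>k. cmod (c k)) summable_on UNIV"
    by (rule comp) (auto simp: distrib_left)
  have c1: "(\<lambda>k. l1 k * cmod (c k)) summable_on UNIV"
  proof (rule comp)
    show "l1 k * cmod (c k) \<le> cmod (c k) * (1 + (l1 k)\<^sup>2)" for k
      using mult_left_mono[OF l1sq, of "cmod (c k)" k] by (simp add: mult.commute)
  qed (simp add: l1_nonneg)
  have d0: "(\<lambda>k. cmod (\<i> * of_int (k $ i) * c k)) summable_on UNIV" for i
  proof (rule comp)
    show "cmod (\<i> * of_int (k $ i) * c k) \<le> cmod (c k) * (1 + (l1 k)\<^sup>2)" for k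
      using mult_left_mono[OF order_trans[OF abs_component_le_l1 l1sq], of "cmod (c k)" k i]
      by (simp add: norm_mult mult.commute)
  qed simp
  have d1: "(\<lambda>k. l1 k * cmod (\<i> * of_int (k $ i) * c k)) summable_on UNIV" for i
  proof (rule comp)
    fix k
    have "l1 k * \<bar>real_of_int (k $ i)\<bar> \<le> l1 k * l1 k"
      using abs_component_le_l1 l1_nonneg by (rule mult_left_mono)
    then have "l1 k * \<bar>real_of_int (k $ i)\<bar> \<le> 1 + (l1 k)\<^sup>2" by (simp add: power2_eq_square)
    from mult_left_mono[OF this, of "cmod (c k)"]
    show "l1 k * cmod (\<i> * of_int (k $ i) * c k) \<le> cmod (c k) * (1 + (l1 k)\<^sup>2)"
      by (simp add: norm_mult mult_ac)
  qed (simp add: l1_nonneg)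
  have d2: "(\<lambda>k. cmod (\<i> * of_int (k $ i) * (\<i> * of_int (k $ i) * c k))) summable_on UNIV" for i
  proof (rule summable_on_comparison_test[OF d1[of i]])
    fix k :: "int ^ 'd"
    show "cmod (\<i> * of_int (k $ i) * (\<i> * of_int (k $ i) * c k))
        \<le> l1 k * cmod (\<i> * of_int (k $ i) * c k)"
      using mult_right_mono[OF abs_component_le_l1[of k i], of "cmod (\<i> * of_int (k $ i) * c k)"]
      by (simp add: norm_mult)
  qed simp
  \<comment> \<open>The inner derivative is again a trigonometric series on real points, so the
    first-order lemma applies to it in turn.\<close>
  have second: "((\<lambda>k. \<i> * of_int (k $ i) * (\<i> * of_int (k $ i) * c k) * mode k (real_point x))
      has_sum partial_deriv i (partial_deriv i u) (real_point x)) UNIV" for i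
    unfolding partial_deriv_trig_series[OF d0 d1 partial_deriv_trig_series[OF c0 c1 u]]
    by (rule trig_series_has_sum[OF d2])
  have "((\<lambda>k. (\<Sum>i\<in>UNIV. complex_of_real ((\<nu> $ i)\<^sup>2) *
          (\<i> * of_int (k $ i) * (\<i> * of_int (k $ i) * c k) * mode k (real_point x)))
        + complex_of_real m * (c k * mode k (real_point x)))
      has_sum L_op \<nu> m u (real_point x)) UNIV"
    unfolding L_op_def
    by (intro has_sum_add has_sum_sum has_sum_cmult_right second, unfold u)
      (rule trig_series_has_sum[OF c0])
  moreover have "(\<Sum>i\<in>UNIV. complex_of_real ((\<nu> $ i)\<^sup>2) *
          (\<i> * of_int (k $ i) * (\<i> * of_int (k $ i) * c k) * mode k (real_point x)))
        + complex_of_real m * (c k * mode k (real_point x))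
      = of_real (eigval \<nu> m k) * c k * mode k (real_point x)" for k
  proof -
    have "(\<Sum>i\<in>UNIV. complex_of_real ((\<nu> $ i)\<^sup>2) *
          (\<i> * of_int (k $ i) * (\<i> * of_int (k $ i) * c k) * mode k (real_point x)))
        = (\<Sum>i\<in>UNIV. complex_of_real ((\<nu> $ i)\<^sup>2 * (real_of_int (k $ i))\<^sup>2) * (- c k * mode k (real_point x)))"
      by (rule sum.cong) (simp_all add: power2_eq_square algebra_simps)
    also have "\<dots> = of_real (\<Sum>i\<in>UNIV. (\<nu> $ i)\<^sup>2 * (real_of_int (k $ i))\<^sup>2) * (- c k * mode k (real_point x))"
      by (simp add: sum_distrib_right sum_negf)
    finally show ?thesis by (simp add: eigval_def algebra_simps)
  qed
  ultimately show ?thesis by simp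
qed

section \<open>The Sobolev spaces and the fixed point\<close>

definition weight :: "real \<Rightarrow> nat \<Rightarrow> int ^ 'd::finite \<Rightarrow> real" where
  "weight \<rho> r k = exp (2 * l1 k * \<rho>) * (1 + (l1 k)\<^sup>2) ^ r"

lemma weight_pos: "0 < weight \<rho> r k"
  unfolding weight_def by (intro mult_pos_pos zero_less_power add_pos_nonneg) auto

lemma weight_nonneg: "0 \<le> weight \<rho> r k"
  using weight_pos less_imp_le by blast

text \<open>Two derivatives cost exactly the factor \<open>1 + (l1 k)\<^sup>2\<close> that the lower
  bound on the eigenvalues supplies.\<close>

lemma sqrt_weight_plus_2: "sqrt (weight \<rho> (p + 2) k) = sqrt (weight \<rho> p k) * (1 + (l1 k)\<^sup>2)"
proof -
  have "weight \<rho> (p + 2) k = weight \<rho> p k * (1 + (l1 k)\<^sup>2)\<^sup>2"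
    by (simp add: weight_def power_add power2_eq_square)
  then show ?thesis by (simp add: real_sqrt_mult)
qed

lemma H_term_eq: "H_term \<rho> r u k = (cmod (fourier_coeff \<rho> u k))\<^sup>2 * weight \<rho> r k"
  by (simp add: H_term_def weight_def mult.assoc)

lemma H_norm_eq: "H_norm \<rho> r u = wnorm (weight \<rho> r) (fourier_coeff \<rho> u)"
  by (simp add: H_norm_def wnorm_def H_term_eq)

lemma real_point_in_strip: "0 \<le> \<rho> \<Longrightarrow> real_point x \<in> strip \<rho>"
  by (simp add: strip_def real_point_def)

lemma norm_mode_le:
  assumes "x \<in> strip \<rho>"
  shows "cmod (mode k x) \<le> exp (l1 k * \<rho>)"
proof -
  have "Re (\<i> * (\<Sum>j\<in>UNIV. of_int (k $ j) * x $ j)) = (\<Sum>j\<in>UNIV. - (real_of_int (k $ j) * Im (x $ j)))"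
    by (simp add: sum_negf)
  also have "\<dots> \<le> (\<Sum>j\<in>UNIV. \<bar>real_of_int (k $ j)\<bar> * \<rho>)"
  proof (rule sum_mono)
    fix j
    have "- (real_of_int (k $ j) * Im (x $ j)) \<le> \<bar>real_of_int (k $ j)\<bar> * \<bar>Im (x $ j)\<bar>"
      by (metis abs_ge_minus_self abs_mult)
    also have "\<dots> \<le> \<bar>real_of_int (k $ j)\<bar> * \<rho>"
      using assms by (intro mult_left_mono) (auto simp: strip_def)
    finally show "- (real_of_int (k $ j) * Im (x $ j)) \<le> \<bar>real_of_int (k $ j)\<bar> * \<rho>" .
  qed
  finally show ?thesis
    by (simp add: mode_def l1_def sum_distrib_right)
qed

text \<open>
  Both terms of the bound \<open>T \<le> T\<^sup>2 Y + 1 / Y\<close> with \<open>Y = (1 + |k|\<^sup>2)\<^sup>p\<close> are summable, which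
  replaces the Cauchy-Schwarz inequality.
\<close>

lemma wl2_weight_summable:
  fixes c :: "int ^ 'd::finite \<Rightarrow> complex"
  assumes p: "CARD('d) < 2 * p" and c: "c \<in> wl2 (weight \<rho> (p + 2 * q))"
  shows "(\<lambda>k. cmod (c k) * exp (l1 k * \<rho>) * (1 + (l1 k)\<^sup>2) ^ q) summable_on UNIV"
proof (rule summable_on_comparison_test)
  show "(\<lambda>k. (cmod (c k))\<^sup>2 * weight \<rho> (p + 2 * q) k + 1 / (1 + (l1 k)\<^sup>2) ^ p) summable_on UNIV"
    using c by (intro summable_on_add summable_on_inverse_l1_power p) (simp add: wl2_def)
  fix k :: "int ^ 'd"
  show "0 \<le> cmod (c k) * exp (l1 k * \<rho>) * (1 + (l1 k)\<^sup>2) ^ q" by simp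
  define T where "T = cmod (c k) * exp (l1 k * \<rho>) * (1 + (l1 k)\<^sup>2) ^ q"
  define Y where "Y = (1 + (l1 k)\<^sup>2) ^ p"
  have Y: "0 < Y" unfolding Y_def by (intro zero_less_power add_pos_nonneg) auto
  have "a \<le> a\<^sup>2 + 1" for a :: real
  proof -
    have "0 \<le> (a - 1)\<^sup>2" by simp
    then have "2 * a \<le> a\<^sup>2 + 1" by (simp add: power2_diff)
    then show ?thesis using zero_le_power2[of a] by linarith
  qed
  \<comment> \<open>Dividing the inequality for \<open>T * Y\<close> by \<open>Y\<close> yields the
    announced bound.\<close>
  from this[of "T * Y"]
  have "T \<le> T\<^sup>2 * Y + 1 / Y"
    using Y by (simp add: field_simps power2_eq_square)
  also have "T\<^sup>2 * Y = (cmod (c k))\<^sup>2 * weight \<rho> (p + 2 * q) k"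
  proof -
    have "exp (2 * l1 k * \<rho>) = (exp (l1 k * \<rho>))\<^sup>2"
      using exp_double[of "l1 k * \<rho>"] by (simp add: mult.assoc)
    moreover have "(1 + (l1 k)\<^sup>2) ^ (p + 2 * q) = (1 + (l1 k)\<^sup>2) ^ p * ((1 + (l1 k)\<^sup>2) ^ q)\<^sup>2"
      by (simp only: power_add power_mult[symmetric] mult.commute[of 2])
    ultimately show ?thesis
      by (simp only: T_def Y_def weight_def power_mult_distrib mult_ac)
  qed
  finally show "T \<le> (cmod (c k))\<^sup>2 * weight \<rho> (p + 2 * q) k + 1 / (1 + (l1 k)\<^sup>2) ^ p"
    by (simp add: Y_def)
qed

lemma fourier_expansion_real_point:
  assumes "0 \<le> \<rho>" "fourier_expansion \<rho> u c"
  shows "((\<lambda>k. c k * mode k (real_point x)) has_sum u (real_point x)) UNIV"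
  using assms(2) real_point_in_strip[OF assms(1)] unfolding fourier_expansion_def by (rule bspec)

text \<open>At the origin every mode equals 1, and unconditional summability of complex numbers is
  absolute summability.\<close>

lemma fourier_expansion_summable:
  assumes "0 \<le> \<rho>" "fourier_expansion \<rho> u c"
  shows "(\<lambda>k. cmod (c k)) summable_on UNIV"
proof -
  have "(\<lambda>k. c k * mode k (real_point 0)) summable_on UNIV"
    by (rule has_sum_imp_summable[OF fourier_expansion_real_point[OF assms]])
  then have "c summable_on UNIV" by (simp add: mode_real_point kdot_def)
  then show ?thesis by (simp add: summable_on_iff_abs_summable_on_complex)
qed

lemma trig_series_coeffs_unique:
  fixes c b :: "int ^ 'd::finite \<Rightarrow> complex"
  assumes c: "(\<lambda>k. cmod (c k)) summable_on UNIV" and b: "(\<lambda>k. cmod (b k)) summable_on UNIV"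
    and cs: "\<And>x. ((\<lambda>k. c k * mode k (real_point x)) has_sum v x) UNIV"
    and bs: "\<And>x. ((\<lambda>k. b k * mode k (real_point x)) has_sum v x) UNIV"
  shows "c = b"
proof
  fix l
  have "((\<lambda>k. (c k - b k) * mode k (real_point x)) has_sum 0) UNIV" for x
  proof -
    have "((\<lambda>k. - (b k * mode k (real_point x))) has_sum - v x) UNIV"
      using bs by (simp add: has_sum_uminus)
    from has_sum_add[OF cs[of x] this] show ?thesis by (simp add: left_diff_distrib)
  qed
  moreover have "(\<lambda>k. cmod (c k - b k)) summable_on UNIV"
    by (rule summable_on_comparison_test[OF summable_on_add[OF c b]]) (auto intro: norm_triangle_ineq4)
  ultimately have "c l - b l = 0" by (intro trig_series_coeff_eq_0)
  then show "c l = b l" by simp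
qed

text \<open>Uniqueness of the expansion is what gives the definite description in
  \<open>fourier_coeff\<close> its value.\<close>

lemma fourier_coeff_eqI:
  assumes "0 \<le> \<rho>" "fourier_expansion \<rho> u c"
  shows "fourier_coeff \<rho> u = c"
  unfolding fourier_coeff_def
proof (rule the_equality)
  fix b assume b: "fourier_expansion \<rho> u b"
  show "b = c"
  proof (rule trig_series_coeffs_unique)
    show "(\<lambda>k. cmod (b k)) summable_on UNIV" "(\<lambda>k. cmod (c k)) summable_on UNIV"
      using assms b fourier_expansion_summable by blast+
    show "((\<lambda>k. b k * mode k (real_point x)) has_sum u (real_point x)) UNIV"
      "((\<lambda>k. c k * mode k (real_point x)) has_sum u (real_point x)) UNIV" for x
      using assms b fourier_expansion_real_point by blast+
  qed
qed fact

section \<open>Passage between functions and coefficient families\<close>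

text \<open>The inverse of \<open>fourier_coeff\<close>. The value zero off the strip matches the
  normalisation in \<open>H_space\<close>, so that \<open>synth_fourier_coeff\<close> is an equality
  of functions on the whole type.\<close>

definition synth :: "real \<Rightarrow> (int ^ 'd::finite \<Rightarrow> complex) \<Rightarrow> complex ^ 'd \<Rightarrow> complex" where
  "synth \<rho> c x = (if x \<in> strip \<rho> then \<Sum>\<^sub>\<infinity>k. c k * mode k x else 0)"

lemma H_space_expansion:
  assumes "0 \<le> \<rho>" "u \<in> H_space \<rho> r"
  shows "fourier_expansion \<rho> u (fourier_coeff \<rho> u)"
  using assms fourier_coeff_eqI by (auto simp: H_space_def)

lemma H_space_coeff_wl2:
  assumes "u \<in> H_space \<rho> r"
  shows "fourier_coeff \<rho> u \<in> wl2 (weight \<rho> r)"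
proof -
  have "H_term \<rho> r u = (\<lambda>k. (cmod (fourier_coeff \<rho> u k))\<^sup>2 * weight \<rho> r k)"
    by (simp add: fun_eq_iff H_term_eq)
  then show ?thesis using assms by (simp add: H_space_def wl2_def)
qed

lemma synth_fourier_coeff:
  assumes "0 \<le> \<rho>" "u \<in> H_space \<rho> r"
  shows "synth \<rho> (fourier_coeff \<rho> u) = u"
proof
  fix x
  show "synth \<rho> (fourier_coeff \<rho> u) x = u x"
    using H_space_expansion[OF assms] assms(2)
    by (auto simp: synth_def fourier_expansion_def H_space_def dest: infsumI)
qed

lemma fourier_expansion_synth:
  fixes c :: "int ^ 'd::finite \<Rightarrow> complex"
  assumes r: "CARD('d) < 2 * r" and c: "c \<in> wl2 (weight \<rho> r)"
  shows "fourier_expansion \<rho> (synth \<rho> c) c"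
  unfolding fourier_expansion_def
proof
  fix x :: "complex ^ 'd" assume x: "x \<in> strip \<rho>"
  have "(\<lambda>k. cmod (c k) * exp (l1 k * \<rho>)) summable_on UNIV"
    using wl2_weight_summable[OF r, of c \<rho> 0] c by simp
  then have "(\<lambda>k. cmod (c k * mode k x)) summable_on UNIV"
    by (rule summable_on_comparison_test) (auto simp: norm_mult intro!: mult_left_mono norm_mode_le x)
  then have "(\<lambda>k. c k * mode k x) summable_on UNIV" by (rule abs_summable_summable)
  then show "((\<lambda>k. c k * mode k x) has_sum synth \<rho> c x) UNIV"
    using x by (simp add: synth_def)
qed

lemma fourier_coeff_synth:
  fixes c :: "int ^ 'd::finite \<Rightarrow> complex"
  assumes "0 \<le> \<rho>" "CARD('d) < 2 * r" "c \<in> wl2 (weight \<rho> r)"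
  shows "fourier_coeff \<rho> (synth \<rho> c) = c"
  using assms by (intro fourier_coeff_eqI fourier_expansion_synth)

lemma synth_in_H_ball:
  fixes c :: "int ^ 'd::finite \<Rightarrow> complex"
  assumes "0 \<le> \<rho>" "CARD('d) < 2 * r" "c \<in> wball (weight \<rho> r) s"
  shows "synth \<rho> c \<in> H_ball \<rho> r s"
proof -
  have c: "c \<in> wl2 (weight \<rho> r)" "wnorm (weight \<rho> r) c \<le> s"
    using assms(3) by (auto simp: wball_def)
  have fc: "fourier_coeff \<rho> (synth \<rho> c) = c"
    using fourier_coeff_synth assms c by blast
  have "H_term \<rho> r (synth \<rho> c) = (\<lambda>k. (cmod (c k))\<^sup>2 * weight \<rho> r k)"
    by (simp add: fun_eq_iff H_term_eq fc)
  then have "synth \<rho> c \<in> H_space \<rho> r"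
    using fourier_expansion_synth[OF assms(2) c(1)] c(1)
    by (auto simp: H_space_def wl2_def synth_def[of \<rho> c])
  then show ?thesis using c(2) by (simp add: H_ball_def H_norm_eq fc)
qed

lemma fourier_coeff_in_wball:
  "u \<in> H_ball \<rho> r s \<Longrightarrow> fourier_coeff \<rho> u \<in> wball (weight \<rho> r) s"
  using H_space_coeff_wl2 by (auto simp: H_ball_def wball_def H_norm_eq)

text \<open>Additivity of \<open>fourier_coeff\<close> is obtained by exhibiting an expansion of the
  difference. This translates the Lipschitz condition into one on coefficient families.\<close>

lemma H_norm_diff:
  fixes u v :: "complex ^ 'd::finite \<Rightarrow> complex"
  assumes \<rho>: "0 \<le> \<rho>" and u: "u \<in> H_space \<rho> r" and v: "v \<in> H_space \<rho> r"
  shows "H_norm \<rho> r (\<lambda>x. u x - v x)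
    = wnorm (weight \<rho> r) (\<lambda>k. fourier_coeff \<rho> u k - fourier_coeff \<rho> v k)"
proof -
  let ?c = "fourier_coeff \<rho> u" and ?b = "fourier_coeff \<rho> v"
  have "fourier_expansion \<rho> (\<lambda>x. u x - v x) (\<lambda>k. ?c k - ?b k)"
    unfolding fourier_expansion_def
  proof
    fix x :: "complex ^ 'd" assume x: "x \<in> strip \<rho>"
    have "((\<lambda>k. ?c k * mode k x) has_sum u x) UNIV"
      using H_space_expansion[OF \<rho> u] x unfolding fourier_expansion_def by (rule bspec)
    moreover have "((\<lambda>k. ?b k * mode k x) has_sum v x) UNIV"
      using H_space_expansion[OF \<rho> v] x unfolding fourier_expansion_def by (rule bspec)
    then have "((\<lambda>k. - (?b k * mode k x)) has_sum - v x) UNIV"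
      by (simp only: has_sum_uminus minus_minus)
    ultimately have "((\<lambda>k. ?c k * mode k x + - (?b k * mode k x)) has_sum u x + - v x) UNIV"
      by (rule has_sum_add)
    then show "((\<lambda>k. (?c k - ?b k) * mode k x) has_sum u x - v x) UNIV"
      by (simp add: left_diff_distrib)
  qed
  then show ?thesis by (simp add: H_norm_eq fourier_coeff_eqI[OF \<rho>])
qed

section \<open>The equation as a fixed-point problem on coefficients\<close>

text \<open>On real points both sides are absolutely convergent trigonometric series, and such
  series determine their coefficients; the equation on the torus therefore suffices even though the
  functions live on the strip.\<close>

lemma equation_iff_coeffs:
  fixes u g :: "complex ^ 'd::finite \<Rightarrow> complex"
  assumes \<rho>: "0 \<le> \<rho>" and p: "CARD('d) < 2 * p"
    and u: "u \<in> H_space \<rho> (p + 2)" and g: "g \<in> H_space \<rho> p"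
  shows "(\<forall>x. L_op \<nu> m u (real_point x) = of_real \<epsilon> * g (real_point x)) \<longleftrightarrow>
    (\<forall>k. of_real (eigval \<nu> m k) * fourier_coeff \<rho> u k = of_real \<epsilon> * fourier_coeff \<rho> g k)"
proof -
  let ?c = "fourier_coeff \<rho> u" and ?f = "fourier_coeff \<rho> g"
  have exp_ge: "1 \<le> exp (l1 k * \<rho>)" for k :: "int ^ 'd"
    using mult_nonneg_nonneg[OF l1_nonneg[of k] \<rho>] by simp
  \<comment> \<open>Here \<open>q = 1\<close>: the two extra orders in \<open>p + 2\<close> pay for
    the factor needed to differentiate twice.\<close>
  have "(\<lambda>k. cmod (?c k) * exp (l1 k * \<rho>) * (1 + (l1 k)\<^sup>2)) summable_on UNIV"
    using wl2_weight_summable[OF p, of ?c \<rho> 1] H_space_coeff_wl2[OF u] by simp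
  then have c2: "(\<lambda>k. cmod (?c k) * (1 + (l1 k)\<^sup>2)) summable_on UNIV"
  proof (rule summable_on_comparison_test)
    fix k :: "int ^ 'd"
    have "cmod (?c k) * 1 \<le> cmod (?c k) * exp (l1 k * \<rho>)"
      by (intro mult_left_mono exp_ge) auto
    then show "cmod (?c k) * (1 + (l1 k)\<^sup>2) \<le> cmod (?c k) * exp (l1 k * \<rho>) * (1 + (l1 k)\<^sup>2)"
      by (intro mult_right_mono) auto
  qed simp
  have ue: "u (real_point x) = (\<Sum>\<^sub>\<infinity>k. ?c k * mode k (real_point x))" for x
    by (rule infsumI[OF fourier_expansion_real_point[OF \<rho> H_space_expansion[OF \<rho> u]], symmetric])
  note L = L_op_trig_series[OF c2 ue, of \<nu> m]
  have ge: "((\<lambda>k. of_real \<epsilon> * ?f k * mode k (real_point x)) has_sum of_real \<epsilon> * g (real_point x)) UNIV" for x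
    using has_sum_cmult_right[OF fourier_expansion_real_point[OF \<rho> H_space_expansion[OF \<rho> g]]]
    by (simp add: mult.assoc)
  have summ: "(\<lambda>k. cmod (b k)) summable_on UNIV"
    if "((\<lambda>k. b k * mode k (real_point 0)) has_sum S) UNIV" for b :: "int ^ 'd \<Rightarrow> complex" and S
  proof -
    have "b summable_on UNIV"
      using has_sum_imp_summable[OF that] by (simp add: mode_real_point kdot_def)
    then show ?thesis by (simp add: summable_on_iff_abs_summable_on_complex)
  qed
  show ?thesis
  proof
    assume eq: "\<forall>x. L_op \<nu> m u (real_point x) = of_real \<epsilon> * g (real_point x)"
    have "(\<lambda>k. of_real (eigval \<nu> m k) * ?c k) = (\<lambda>k. of_real \<epsilon> * ?f k)"
      using eq L by (intro trig_series_coeffs_unique[OF summ[OF L] summ[OF ge] _ ge]) simp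
    then show "\<forall>k. of_real (eigval \<nu> m k) * ?c k = of_real \<epsilon> * ?f k" by meson
  next
    assume "\<forall>k. of_real (eigval \<nu> m k) * ?c k = of_real \<epsilon> * ?f k"
    then show "\<forall>x. L_op \<nu> m u (real_point x) = of_real \<epsilon> * g (real_point x)"
      using L ge by (auto intro: has_sum_unique)
  qed
qed

text \<open>The inequality \<open>small\<close> yields both requirements of the contraction
  principle: the rate \<open>\<epsilon> / \<gamma> * L\<close> is below 1, and the ball is mapped
  into itself because the norm of \<open>F u\<close> is at most that of \<open>F\<close> at zero
  plus \<open>L * s\<close>.\<close>

lemma unique_solution_nonresonant:
  fixes F :: "(complex ^ 'd::finite \<Rightarrow> complex) \<Rightarrow> complex ^ 'd \<Rightarrow> complex"
  assumes \<rho>: "0 \<le> \<rho>" and p: "CARD('d) < 2 * p" and s: "0 < s"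
    and F: "lipschitz_on_ball \<rho> (p + 2) s L F"
    and \<epsilon>: "0 < \<epsilon>" and \<gamma>: "0 < \<gamma>"
    and lower: "\<And>k :: int ^ 'd. \<gamma> * (1 + (l1 k)\<^sup>2) \<le> \<bar>eigval \<nu> m k\<bar>"
    and small: "\<epsilon> * (H_norm \<rho> p (F (\<lambda>x. 0)) + L * s + s) < \<gamma> * s"
  shows "\<exists>!u. u \<in> H_ball \<rho> (p + 2) s \<and>
    (\<forall>x. L_op \<nu> m u (real_point x) = of_real \<epsilon> * F u (real_point x))"
proof -
  define w v :: "int ^ 'd \<Rightarrow> real" where "w = weight \<rho> (p + 2)" and "v = weight \<rho> p"
  define f where "f c = fourier_coeff \<rho> (F (synth \<rho> c))" for c
  define \<Phi> where "\<Phi> c k = of_real \<epsilon> * f c k / of_real (eigval \<nu> m k)" for c k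
  have p2: "CARD('d) < 2 * (p + 2)" using p by simp
  have wv: "\<And>k. 0 < w k" "\<And>k. 0 \<le> w k" "\<And>k. 0 \<le> v k"
    by (simp_all add: w_def v_def weight_pos weight_nonneg)
  have L: "0 \<le> L" and FH: "\<And>u. u \<in> H_ball \<rho> (p + 2) s \<Longrightarrow> F u \<in> H_space \<rho> p"
    and FL: "\<And>u u'. u \<in> H_ball \<rho> (p + 2) s \<Longrightarrow> u' \<in> H_ball \<rho> (p + 2) s \<Longrightarrow>
      H_norm \<rho> p (\<lambda>x. F u x - F u' x) \<le> L * H_norm \<rho> (p + 2) (\<lambda>x. u x - u' x)"
    using F by (auto simp: lipschitz_on_ball_def)
  have ball: "synth \<rho> c \<in> H_ball \<rho> (p + 2) s" "fourier_coeff \<rho> (synth \<rho> c) = c"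
    "synth \<rho> c \<in> H_space \<rho> (p + 2)" if "c \<in> wball w s" for c
    using synth_in_H_ball[OF \<rho> p2, of c s] fourier_coeff_synth[OF \<rho> p2, of c] that
    by (auto simp: w_def wball_def H_ball_def)
  have fv: "f c \<in> wl2 v" if "c \<in> wball w s" for c
    using H_space_coeff_wl2[OF FH[OF ball(1)[OF that]]] by (simp add: f_def v_def)
  have f_lip: "wnorm v (\<lambda>k. f c k - f b k) \<le> L * wnorm w (\<lambda>k. c k - b k)"
    if "c \<in> wball w s" "b \<in> wball w s" for c b
    using FL[OF ball(1)[OF that(1)] ball(1)[OF that(2)]]
      H_norm_diff[OF \<rho> FH[OF ball(1)[OF that(1)]] FH[OF ball(1)[OF that(2)]]]
      H_norm_diff[OF \<rho> ball(3)[OF that(1)] ball(3)[OF that(2)]]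
      ball(2)[OF that(1)] ball(2)[OF that(2)]
    by (simp add: f_def v_def w_def)
  \<comment> \<open>Division by the eigenvalue gains
    \<open>1 / (\<gamma> * (1 + (l1 k)\<^sup>2))\<close>, which cancels the ratio of the square
    roots of the two weights.\<close>
  have gain: "cmod (of_real \<epsilon> * z / of_real (eigval \<nu> m k)) * sqrt (w k)
      \<le> \<epsilon> / \<gamma> * (cmod z * sqrt (v k))" for z k
  proof -
    have pos: "0 < 1 + (l1 k)\<^sup>2" by (intro add_pos_nonneg) auto
    have "(1 + (l1 k)\<^sup>2) / \<bar>eigval \<nu> m k\<bar> \<le> 1 / \<gamma>"
      using lower[of k] \<gamma> pos mult_pos_pos[OF \<gamma> pos] by (simp add: field_simps)
    then have "\<epsilon> * cmod z * sqrt (v k) * ((1 + (l1 k)\<^sup>2) / \<bar>eigval \<nu> m k\<bar>)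
        \<le> \<epsilon> * cmod z * sqrt (v k) * (1 / \<gamma>)"
      using \<epsilon> wv by (intro mult_left_mono) auto
    then show ?thesis
      using \<epsilon> unfolding w_def sqrt_weight_plus_2 by (simp add: v_def norm_mult norm_divide mult_ac)
  qed
  have q: "0 \<le> \<epsilon> / \<gamma>" using \<epsilon> \<gamma> by simp
  have zero: "(\<lambda>k. 0) \<in> wball w s" using s by (simp add: wball_def wl2_zero wnorm_zero)
  have synth0: "synth \<rho> (\<lambda>k. 0) = (\<lambda>x. 0)" by (simp add: fun_eq_iff synth_def)
  have M: "wnorm v (f (\<lambda>k. 0)) = H_norm \<rho> p (F (\<lambda>x. 0))"
    by (simp add: f_def synth0 H_norm_eq v_def)
  have "\<exists>!c. c \<in> wball w s \<and> \<Phi> c = c"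
  proof (rule wball_contraction_fixpoint[where q = "\<epsilon> / \<gamma> * L"])
    have "0 \<le> H_norm \<rho> p (F (\<lambda>x. 0))" unfolding H_norm_eq by (intro wnorm_nonneg weight_nonneg)
    then have "\<epsilon> * (L * s) < \<epsilon> * (H_norm \<rho> p (F (\<lambda>x. 0)) + L * s + s)"
      using \<epsilon> s by (intro mult_strict_left_mono) auto
    then have "(\<epsilon> * L) * s < \<gamma> * s" using small by (simp add: mult.assoc)
    then show "\<epsilon> / \<gamma> * L < 1" using s \<gamma> by (simp add: field_simps)
  next
    fix c assume c: "c \<in> wball w s"
    have "wnorm w (\<lambda>k. c k - 0) \<le> s" using c by (simp add: wball_def)
    then have "wnorm v (\<lambda>k. f c k - f (\<lambda>k. 0) k) \<le> L * s"
      using f_lip[OF c zero] L by (meson mult_left_mono order_trans)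
    then have "wnorm v (f c) \<le> L * s + wnorm v (f (\<lambda>k. 0))"
      using wnorm_triangle[OF wv(3) wl2_diff[OF wv(3) fv[OF c] fv[OF zero]] fv[OF zero]] by simp
    then have "\<epsilon> / \<gamma> * wnorm v (f c) \<le> \<epsilon> / \<gamma> * (L * s + wnorm v (f (\<lambda>k. 0)))"
      using q by (rule mult_left_mono)
    moreover have "\<epsilon> / \<gamma> * (L * s + wnorm v (f (\<lambda>k. 0))) \<le> s"
    proof -
      have "\<epsilon> * (L * s + wnorm v (f (\<lambda>k. 0))) \<le> \<gamma> * s"
        using small mult_pos_pos[OF \<epsilon> s] by (simp add: M algebra_simps)
      then show ?thesis using \<gamma> by (simp add: field_simps)
    qed
    ultimately show "\<Phi> c \<in> wball w s"
      using wl2_scaled_le[OF wv(3) wv(2) fv[OF c] q, of "\<Phi> c"] gain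
      by (fastforce simp: wball_def \<Phi>_def)
  next
    fix c b assume c: "c \<in> wball w s" and b: "b \<in> wball w s"
    have "wnorm w (\<lambda>k. \<Phi> c k - \<Phi> b k) \<le> \<epsilon> / \<gamma> * wnorm v (\<lambda>k. f c k - f b k)"
    proof (rule wnorm_scaled_le[OF wv(3) wv(2) wl2_diff[OF wv(3) fv[OF c] fv[OF b]] q])
      fix k
      show "cmod (\<Phi> c k - \<Phi> b k) * sqrt (w k) \<le> \<epsilon> / \<gamma> * (cmod (f c k - f b k) * sqrt (v k))"
        using gain[of "f c k - f b k" k] by (simp add: \<Phi>_def right_diff_distrib diff_divide_distrib)
    qed
    also have "\<dots> \<le> \<epsilon> / \<gamma> * (L * wnorm w (\<lambda>k. c k - b k))"
      using f_lip[OF c b] q by (rule mult_left_mono)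
    finally show "wnorm w (\<lambda>k. \<Phi> c k - \<Phi> b k) \<le> \<epsilon> / \<gamma> * L * wnorm w (\<lambda>k. c k - b k)"
      by (simp add: mult.assoc)
  qed (use wv s in auto)
  then obtain c where c: "c \<in> wball w s" "\<Phi> c = c"
    and c_unique: "\<And>b. b \<in> wball w s \<Longrightarrow> \<Phi> b = b \<Longrightarrow> b = c"
    by blast
  have eig: "eigval \<nu> m k \<noteq> 0" for k
  proof -
    have "0 < \<gamma> * (1 + (l1 k)\<^sup>2)" using \<gamma> by (intro mult_pos_pos add_pos_nonneg) auto
    then show ?thesis using lower[of k] by auto
  qed
  \<comment> \<open>Since no eigenvalue vanishes, the coefficient equation can be divided by it, and
    \<open>synth\<close> of the coefficients recovers \<open>u\<close> inside
    \<open>F\<close>.\<close>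
  have fix_iff: "(\<forall>x. L_op \<nu> m u (real_point x) = of_real \<epsilon> * F u (real_point x)) \<longleftrightarrow>
      \<Phi> (fourier_coeff \<rho> u) = fourier_coeff \<rho> u" if u: "u \<in> H_ball \<rho> (p + 2) s" for u
  proof -
    have uH: "u \<in> H_space \<rho> (p + 2)" using u by (simp add: H_ball_def)
    show ?thesis
      unfolding equation_iff_coeffs[OF \<rho> p uH FH[OF u]]
      using eig by (auto simp: \<Phi>_def f_def synth_fourier_coeff[OF \<rho> uH] fun_eq_iff field_simps)
  qed
  show ?thesis
  proof (rule ex1I[of _ "synth \<rho> c"])
    show "synth \<rho> c \<in> H_ball \<rho> (p + 2) s \<and>
      (\<forall>x. L_op \<nu> m (synth \<rho> c) (real_point x) = of_real \<epsilon> * F (synth \<rho> c) (real_point x))"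
      using fix_iff[OF ball(1)[OF c(1)]] ball[OF c(1)] c(2) by simp
    fix u assume u: "u \<in> H_ball \<rho> (p + 2) s \<and>
      (\<forall>x. L_op \<nu> m u (real_point x) = of_real \<epsilon> * F u (real_point x))"
    then have "fourier_coeff \<rho> u = c"
      using fix_iff[of u] fourier_coeff_in_wball[of u \<rho> "p + 2" s] c_unique by (simp add: w_def)
    then show "u = synth \<rho> c"
      using synth_fourier_coeff[OF \<rho>, of u "p + 2"] u by (auto simp: H_ball_def)
  qed
qed

text \<open>The third argument of \<open>eps_star\<close> is the norm of \<open>F\<close> at the
  zero function: a Lipschitz constant bounds differences of values but not their size, as constant
  maps show. The function \<open>eps_star\<close> is fixed before \<open>\<rho>\<close>,
  \<open>r\<close> and \<open>F\<close>, and its values are uniform in \<open>\<nu>\<close>.\<close>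

theorem theorem8:
  fixes m :: real
  assumes "m > 0"
  shows "\<exists>\<delta>\<^sub>0>0. \<exists>C>0. \<forall>\<delta>. 0 < \<delta> \<and> \<delta> < \<delta>\<^sub>0 \<longrightarrow>
    (\<exists>eps_star :: real \<Rightarrow> real \<Rightarrow> real \<Rightarrow> real.
       (\<forall>s L M. 0 < s \<and> 0 \<le> L \<and> 0 \<le> M \<longrightarrow> 0 < eps_star s L M) \<and>
       (\<forall>(\<rho>::real) (r::nat) (s::real) (L::real)
          (F :: (complex ^ 'd::finite \<Rightarrow> complex) \<Rightarrow> complex ^ 'd \<Rightarrow> complex).
          0 \<le> \<rho> \<and> real r - 2 > real CARD('d) / 2 \<and> 0 < s \<and> lipschitz_on_ball \<rho> r s L F \<longrightarrow>
          (\<exists>I :: (real ^ 'd) set.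
             I \<subseteq> freq_box \<and> I \<in> sets lebesgue \<and> measure lebesgue I \<le> C * \<delta> \<and>
             (\<forall>\<epsilon>. 0 < \<epsilon> \<and> \<epsilon> < eps_star s L (H_norm \<rho> (r - 2) (F (\<lambda>x. 0))) \<longrightarrow>
               (\<forall>\<nu>\<in>freq_box - I.
                  \<exists>!u. u \<in> H_ball \<rho> r s \<and>
                    (\<forall>x :: real ^ 'd.
                       L_op \<nu> m u (real_point x) = complex_of_real \<epsilon> * F u (real_point x)))))))"
    (is "\<exists>\<delta>\<^sub>0>0. \<exists>C>0. \<forall>\<delta>. _ \<longrightarrow> ?P C \<delta>")
proof -
  \<comment> \<open>The added 1 keeps \<open>C\<close> positive when there are no low modes.\<close>
  define C where "C = real (card (low_modes m :: (int ^ 'd) set)) * (4 * 2 ^ CARD('d)) + 1"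
  have "?P C \<delta>" if \<delta>: "0 < \<delta>" "\<delta> < 1 / 2" for \<delta>
  proof -
    define I :: "(real ^ 'd) set" where "I = (\<Union>k\<in>low_modes m. resonant m \<delta> k)"
    obtain \<gamma> where \<gamma>: "0 < \<gamma>"
      and lower: "\<And>\<nu> (k :: int ^ 'd). \<nu> \<in> freq_box - I \<Longrightarrow> \<gamma> * (1 + (l1 k)\<^sup>2) \<le> \<bar>eigval \<nu> m k\<bar>"
      using eigval_lower_bound[OF assms \<delta>(1), where 'd = 'd] unfolding I_def by blast
    have I: "I \<subseteq> freq_box" "I \<in> sets lebesgue" "measure lebesgue I \<le> C * \<delta>"
    proof -
      show "I \<subseteq> freq_box" by (auto simp: I_def resonant_def)
      show "I \<in> sets lebesgue"
        unfolding I_def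
        by (intro sets.finite_UN finite_low_modes fmeasurableD lmeasurable_compact compact_resonant)
      show "measure lebesgue I \<le> C * \<delta>"
        using measure_resonant_union_le[OF \<delta>, of m, where 'd = 'd] \<delta>(1)
        by (simp add: I_def C_def distrib_right)
    qed
    \<comment> \<open>This solves the inequality \<open>small\<close> of
      \<open>unique_solution_nonresonant\<close> for \<open>\<epsilon>\<close>; the last summand
      keeps the denominator positive when \<open>L\<close> and \<open>M\<close> vanish.\<close>
    define eps_star where "eps_star s L M = \<gamma> * s / (M + L * s + s)" for s L M :: real
    have den: "0 < M + L * s + s" if "0 < s" "0 \<le> L" "0 \<le> M" for s L M :: real
      using that by (intro add_nonneg_pos add_nonneg_nonneg mult_nonneg_nonneg) auto
    show ?thesis
    proof (rule exI[of _ eps_star], intro conjI allI impI)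
      fix s L M :: real assume "0 < s \<and> 0 \<le> L \<and> 0 \<le> M"
      then show "0 < eps_star s L M"
        using \<gamma> den by (simp add: eps_star_def)
    next
      fix \<rho> :: real and r :: nat and s L :: real
        and F :: "(complex ^ 'd \<Rightarrow> complex) \<Rightarrow> complex ^ 'd \<Rightarrow> complex"
      assume *: "0 \<le> \<rho> \<and> real r - 2 > real CARD('d) / 2 \<and> 0 < s \<and> lipschitz_on_ball \<rho> r s L F"
      define p where "p = r - 2"
      \<comment> \<open>This makes the natural-number subtraction in \<open>p\<close> exact.\<close>
      have "2 < real r" using * zero_less_card_finite[where 'a = 'd]
        by (smt (verit) divide_nonneg_nonneg of_nat_0_le_iff zero_le_numeral)
      then have r: "r = p + 2" by (simp add: p_def)
      then have p: "CARD('d) < 2 * p" using * by (simp add: field_simps)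
      have L: "0 \<le> L" using * by (simp add: lipschitz_on_ball_def)
      have M: "0 \<le> H_norm \<rho> p (F (\<lambda>x. 0))"
        unfolding H_norm_eq by (intro wnorm_nonneg weight_nonneg)
      have "\<exists>!u. u \<in> H_ball \<rho> r s \<and>
          (\<forall>x :: real ^ 'd. L_op \<nu> m u (real_point x) = complex_of_real \<epsilon> * F u (real_point x))"
        if \<epsilon>: "0 < \<epsilon>" "\<epsilon> < eps_star s L (H_norm \<rho> (r - 2) (F (\<lambda>x. 0)))" and \<nu>: "\<nu> \<in> freq_box - I" for \<epsilon> \<nu>
        unfolding r
      proof (rule unique_solution_nonresonant[OF _ p _ _ \<epsilon>(1) \<gamma> lower[OF \<nu>]])
        show "0 \<le> \<rho>" "0 < s" "lipschitz_on_ball \<rho> (p + 2) s L F" using * by (simp_all add: r)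
        show "\<epsilon> * (H_norm \<rho> p (F (\<lambda>x. 0)) + L * s + s) < \<gamma> * s"
          using \<epsilon>(2) den[of s L "H_norm \<rho> p (F (\<lambda>x. 0))"] * L M
          by (simp add: eps_star_def r pos_less_divide_eq)
      qed
      note solution = this
      show "\<exists>I :: (real ^ 'd) set.
             I \<subseteq> freq_box \<and> I \<in> sets lebesgue \<and> measure lebesgue I \<le> C * \<delta> \<and>
             (\<forall>\<epsilon>. 0 < \<epsilon> \<and> \<epsilon> < eps_star s L (H_norm \<rho> (r - 2) (F (\<lambda>x. 0))) \<longrightarrow>
               (\<forall>\<nu>\<in>freq_box - I.
                  \<exists>!u. u \<in> H_ball \<rho> r s \<and>
                    (\<forall>x :: real ^ 'd.
                       L_op \<nu> m u (real_point x) = complex_of_real \<epsilon> * F u (real_point x))))"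
        by (rule exI[of _ I], intro conjI I allI impI ballI, elim conjE, rule solution)
    qed
  qed
  then have "\<forall>\<delta>. 0 < \<delta> \<and> \<delta> < 1 / 2 \<longrightarrow> ?P C \<delta>" by blast
  moreover have "0 < C" unfolding C_def by (rule add_nonneg_pos) auto
  moreover have "0 < (1 / 2 :: real)" by simp
  ultimately show ?thesis by blast
qed

end
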